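(* Let $n\ge1$ and let $f(x)=(f_1(x_1),\dots,f_n(x_n))$ for $x=(x_1,\dots,x_n)\in\mathbf R^{2n}$, $x_k\in\mathbf R^2$, where each $f_k\in C^1(\mathbf R^2,\mathbf R^2)$ is such that for the planar system $\dot x_k=f_k(x_k)$ the origin is the unique equilibrium point and all other trajectories are closed curves surrounding the origin. Let $g\in C^{0,1}_{t,x}(\mathbf R\times\mathbf R^{2n},\mathbf R^{2n})$, and suppose that for some real $p>2$ at least one of the following (equivalent) assumptions holds: (i) $t^p\|g(t,x)\|\to0$ as $t\to+\infty$, uniformly with respect to $x$ on compact subsets of $\mathbf R^{2n}$; (ii) there are positive continuous scalar functions $\alpha(s)$, $\beta(t)$ with $\alpha$ increasing, $\beta$ decreasing, $\lim_{t\to\infty}\beta(t)=0$, and $t^p\|g(t,x)\|\le\alpha(\|x\|)\beta(t)$. Then each bounded solution $x(t)$ of $\dot x=f(x)+g(t,x)$ converges to a certain solution of the unperturbed system $\dot x=f(x)$; that is, there is a solution $y(t)$ of $\dot y=f(y)$ such that $\lim_{t\to+\infty}\|x(t)-y(t)\|=0$.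
   Context: $C^{0,1}_{t,x}$ denotes functions continuous in $(t,x)$ and continuously differentiable with respect to $x$. $\|\cdot\|$ is the Euclidean norm. A bounded solution is a solution $x(t)$ defined on some half-line $[t_0,+\infty)$ with $\sup_{t\ge t_0}\|x(t)\|<\infty$. *)

theory Defs
  imports "HOL-Analysis.Analysis"
begin

definition C1_map :: "('a::euclidean_space \<Rightarrow> 'b::euclidean_space) \<Rightarrow> bool" where
  "C1_map F \<longleftrightarrow>
     (\<exists>F'. (\<forall>x. (F has_derivative blinfun_apply (F' x)) (at x)) \<and> continuous_on UNIV F')"

text \<open>The class \<open>C\<^sup>0\<^sup>,\<^sup>1\<close> in \<open>(t, x)\<close>: both \<open>g\<close> and its partial derivative in \<open>x\<close> are jointly
  continuous in \<open>(t, x)\<close>.\<close>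

definition C01_map :: "(real \<Rightarrow> 'a::euclidean_space \<Rightarrow> 'b::euclidean_space) \<Rightarrow> bool" where
  "C01_map g \<longleftrightarrow>
     continuous_on UNIV (\<lambda>(t, x). g t x) \<and>
     (\<exists>g'. (\<forall>t x. (g t has_derivative blinfun_apply (g' t x)) (at x)) \<and>
           continuous_on UNIV (\<lambda>(t, x). g' t x))"

text \<open>Derivatives at an endpoint belonging to \<open>I\<close> are one-sided.\<close>

definition ode_solution_on ::
    "(real \<Rightarrow> 'a::real_normed_vector \<Rightarrow> 'a) \<Rightarrow> (real \<Rightarrow> 'a) \<Rightarrow> real set \<Rightarrow> bool" where
  "ode_solution_on F u I \<longleftrightarrow>
     (\<forall>t\<in>I. (u has_vector_derivative F t (u t)) (at t within I))"

definition maximal_ode_solution_on ::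
    "(real \<Rightarrow> 'a::real_normed_vector \<Rightarrow> 'a) \<Rightarrow> (real \<Rightarrow> 'a) \<Rightarrow> real set \<Rightarrow> bool" where
  "maximal_ode_solution_on F u I \<longleftrightarrow>
     open I \<and> is_interval I \<and> I \<noteq> {} \<and> ode_solution_on F u I \<and>
     (\<forall>v J. open J \<and> is_interval J \<and> I \<subseteq> J \<and> ode_solution_on F v J \<and> (\<forall>t\<in>I. v t = u t)
        \<longrightarrow> J = I)"

definition trajectory :: "('a::real_normed_vector \<Rightarrow> 'a) \<Rightarrow> 'a set \<Rightarrow> bool" where
  "trajectory F C \<longleftrightarrow> (\<exists>u I. maximal_ode_solution_on (\<lambda>t. F) u I \<and> C = u ` I)"

definition closed_curve :: "'a::real_normed_vector set \<Rightarrow> bool" where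
  "closed_curve C \<longleftrightarrow>
     (\<exists>c. simple_path c \<and> pathfinish c = pathstart c \<and> path_image c = C)"

text \<open>A global center at the origin. The curve \<open>C\<close> surrounds the origin when the origin lies in a
  bounded component of the complement of \<open>C\<close>; the trajectory \<open>{0}\<close> is that of the equilibrium.\<close>

definition global_center :: "(real ^ 2 \<Rightarrow> real ^ 2) \<Rightarrow> bool" where
  "global_center F \<longleftrightarrow>
     (\<forall>x. F x = 0 \<longleftrightarrow> x = 0) \<and>
     (\<forall>C. trajectory F C \<and> C \<noteq> {0} \<longrightarrow> closed_curve C \<and> 0 \<in> inside C)"

text \<open>The space of \<open>n\<close>-tuples of points of the plane is \<open>(real ^ 2) ^ 'n\<close> with
  \<open>n = CARD('n)\<close>; its norm is the Euclidean norm of the \<open>2n\<close> real coordinates.\<close>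

definition product_field ::
    "('n::finite \<Rightarrow> real ^ 2 \<Rightarrow> real ^ 2) \<Rightarrow> (real ^ 2) ^ 'n \<Rightarrow> (real ^ 2) ^ 'n" where
  "product_field f x = (\<chi> k. f k (x $ k))"

definition decays_locally_uniformly ::
    "real \<Rightarrow> (real \<Rightarrow> 'a::euclidean_space \<Rightarrow> 'a) \<Rightarrow> bool" where
  "decays_locally_uniformly p g \<longleftrightarrow>
     (\<forall>K. compact K \<longrightarrow> uniform_limit K (\<lambda>t x. t powr p * norm (g t x)) (\<lambda>x. 0) at_top)"

text \<open>Since \<open>p\<close> is real, \<open>t\<^sup>p\<close> is considered for \<open>t > 0\<close> only, and \<open>\<alpha>\<close> only on the range \<open>{0..}\<close> of
  the norm. Monotonicity is not required to be strict.\<close>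

definition decays_by_product_bound ::
    "real \<Rightarrow> (real \<Rightarrow> 'a::euclidean_space \<Rightarrow> 'a) \<Rightarrow> bool" where
  "decays_by_product_bound p g \<longleftrightarrow>
     (\<exists>(\<alpha>::real \<Rightarrow> real) (\<beta>::real \<Rightarrow> real).
        continuous_on {0..} \<alpha> \<and> (\<forall>s\<ge>0. 0 < \<alpha> s) \<and> mono_on {0..} \<alpha> \<and>
        continuous_on {0<..} \<beta> \<and> (\<forall>t>0. 0 < \<beta> t) \<and> antimono_on {0<..} \<beta> \<and>
        (\<beta> \<longlongrightarrow> 0) at_top \<and>
        (\<forall>t>0. \<forall>x. t powr p * norm (g t x) \<le> \<alpha> (norm x) * \<beta> t))"

end

theory Submission
  imports Defs
begin

text \<open>The components decouple: each satisfies \<open>u' = F u + h\<close> with \<open>F\<close> a planar center and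
  \<open>h\<close> of size at most \<open>t\<^sup>-\<^sup>p\<close>. If \<open>u\<close> does not tend to the equilibrium, it returns infinitely often
  near some \<open>z \<noteq> 0\<close>. Near \<open>z\<close> there is a Lipschitz function assigning to every point a period of its
  orbit, so the flow \<open>\<phi> t\<close> of \<open>F\<close> has Lipschitz constant at most \<open>C (1 + \<bar>t\<bar>)\<close> along the nearby
  orbits: neighbouring orbits separate by a linearly growing phase shift only. Pulling \<open>u (N + i)\<close>
  back by \<open>\<phi> (- i)\<close>, consecutive points differ by \<open>O((N + i)\<^sup>1\<^sup>-\<^sup>p)\<close>, which is summable because
  \<open>p > 2\<close>; the limit is the initial value of the asymptotic unperturbed solution.\<close>

text \<open>Decoupling is possible because along one given bounded solution the coupling term
  \<open>g t (x t)\<close> is a known function of time; its component is the inhomogeneity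
  \<open>h\<close>. Exponential growth, which is all that Gronwall's inequality gives, would defeat
  every power of \<open>t\<close>; hence the detour through periods. The regularity of
  \<open>F\<close> enters as Lipschitz bounds on balls, so no derivative of the flow in the initial
  point is at hand: crossing times and periods are compared directly, through the positive speed of
  the flow across a section. The center hypothesis describes orbits as point sets, so even
  periodicity of the solutions has to be derived. The estimates hold only in a tube around the orbit
  of \<open>z\<close>, and nothing says beforehand that \<open>u\<close> stays in it. But the width
  of the tube and its constants depend on \<open>z\<close> alone, so a return to \<open>z\<close>
  that is late enough leaves a total drift, of order \<open>N\<close> to the power 2 - p, below half
  the width: the solution is then trapped.\<close>

subsection \<open>Differential equations with a Lipschitz field\<close>

text \<open>Energy method: the squared norm is differentiable where the norm is not. Young's
  inequality splits the cross term into |w|^2 + e^2, whence the rate \<open>M = 2 * L + 1\<close>,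
  and adding \<open>e\<^sup>2\<close> to the energy absorbs the source term. The summand 1 in
  \<open>exp (L + 1)\<close> is the price, rounded up from 1/2.\<close>

lemma gronwall_unit:
  fixes w w' :: "real \<Rightarrow> 'a::real_inner"
  assumes d: "\<And>t. t \<in> {0..1} \<Longrightarrow> (w has_vector_derivative w' t) (at t within {0..1})"
    and b: "\<And>t. t \<in> {0..1} \<Longrightarrow> norm (w' t) \<le> L * norm (w t) + e"
    and L: "L \<ge> 0" and e: "e \<ge> 0"
  shows "norm (w 1) \<le> exp (L + 1) * (norm (w 0) + e)"
proof -
  define M where "M = 2 * L + 1"
  define q where "q t = exp (- M * t) * (w t \<bullet> w t + e\<^sup>2)" for t
  have der: "(q has_derivative (\<lambda>h. h * (exp (- M * t) * (2 * (w t \<bullet> w' t) - M * (w t \<bullet> w t + e\<^sup>2)))))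
      (at t within {0..1})" if t: "t \<in> {0..1}" for t
    unfolding q_def
    by (rule derivative_eq_intros refl d[OF t, unfolded has_vector_derivative_def])+
       (simp add: algebra_simps inner_commute)
  have neg: "2 * (w t \<bullet> w' t) - M * (w t \<bullet> w t + e\<^sup>2) \<le> 0" if t: "t \<in> {0..1}" for t
  proof -
    have "w t \<bullet> w' t \<le> norm (w t) * norm (w' t)"
      by (rule norm_cauchy_schwarz)
    also have "\<dots> \<le> norm (w t) * (L * norm (w t) + e)"
      using b[OF t] by (intro mult_left_mono) auto
    also have "\<dots> = L * (norm (w t))\<^sup>2 + norm (w t) * e"
      by (simp add: algebra_simps power2_eq_square)
    finally have 1: "w t \<bullet> w' t \<le> L * (norm (w t))\<^sup>2 + norm (w t) * e" .
    have 2: "2 * (norm (w t) * e) \<le> (norm (w t))\<^sup>2 + e\<^sup>2"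
      using sum_squares_bound[of "norm (w t)" e] by simp
    have 3: "0 \<le> L * e\<^sup>2" using L by simp
    have "w t \<bullet> w t = (norm (w t))\<^sup>2" by (simp add: power2_norm_eq_inner)
    then show ?thesis using 1 2 3 unfolding M_def by (simp add: algebra_simps)
  qed
  obtain t where t: "t \<in> {0..1}" and "q 1 - q 0 =
      (\<lambda>h. h * (exp (- M * t) * (2 * (w t \<bullet> w' t) - M * (w t \<bullet> w t + e\<^sup>2)))) (1 - 0)"
    using mvt_very_simple[of 0 1 q, OF _ der] by auto
  moreover have "exp (- M * t) * (2 * (w t \<bullet> w' t) - M * (w t \<bullet> w t + e\<^sup>2)) \<le> 0"
    using neg[OF t] by (intro mult_nonneg_nonpos) auto
  ultimately have "q 1 \<le> q 0" by simp
  then have "exp (- M) * (w 1 \<bullet> w 1 + e\<^sup>2) \<le> w 0 \<bullet> w 0 + e\<^sup>2"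
    by (simp add: q_def)
  then have "exp M * (exp (- M) * (w 1 \<bullet> w 1 + e\<^sup>2)) \<le> exp M * (w 0 \<bullet> w 0 + e\<^sup>2)"
    by (intro mult_left_mono) auto
  then have "w 1 \<bullet> w 1 + e\<^sup>2 \<le> exp M * (w 0 \<bullet> w 0 + e\<^sup>2)"
    by (simp add: mult.assoc[symmetric] flip: exp_add)
  then have "(norm (w 1))\<^sup>2 \<le> exp M * ((norm (w 0))\<^sup>2 + e\<^sup>2)"
    unfolding power2_norm_eq_inner using zero_le_power2[of e] by linarith
  also have "\<dots> \<le> (exp (L + 1))\<^sup>2 * (norm (w 0) + e)\<^sup>2"
    using L e by (intro mult_mono) (auto simp: M_def power2_sum simp flip: exp_double)
  finally show ?thesis
    using e by (intro power2_le_imp_le[of "norm (w 1)"]) (auto simp: power_mult_distrib)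
qed

text \<open>Reparametrising the unit interval scales both \<open>L\<close> and \<open>e\<close> by
  |t - s|. A closed segment also covers t < s, which is needed because flows are run backwards
  too.\<close>

lemma gronwall:
  fixes w w' :: "real \<Rightarrow> 'a::real_inner"
  assumes d: "\<And>r. r \<in> closed_segment s t \<Longrightarrow>
        (w has_vector_derivative w' r) (at r within closed_segment s t)"
    and b: "\<And>r. r \<in> closed_segment s t \<Longrightarrow> norm (w' r) \<le> L * norm (w r) + e"
    and L: "L \<ge> 0" and e: "e \<ge> 0"
  shows "norm (w t) \<le> exp (L * \<bar>t - s\<bar> + 1) * (norm (w s) + e * \<bar>t - s\<bar>)"
proof -
  define c where "c r = s + r * (t - s)" for r :: real
  have c: "c r \<in> closed_segment s t" if "r \<in> {0..1}" for r
    using that by (auto simp: c_def in_segment algebra_simps intro!: exI[of _ r])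
  have "norm ((w \<circ> c) 1) \<le> exp (L * \<bar>t - s\<bar> + 1) * (norm ((w \<circ> c) 0) + e * \<bar>t - s\<bar>)"
  proof (rule gronwall_unit[where w' = "\<lambda>r. (t - s) *\<^sub>R w' (c r)"])
    fix r :: real assume r: "r \<in> {0..1}"
    have "(c has_vector_derivative (t - s)) (at r within {0..1})"
      unfolding c_def has_vector_derivative_def
      by (auto intro!: derivative_eq_intros)
    moreover have "(w has_vector_derivative w' (c r)) (at (c r) within c ` {0..1})"
      using c by (intro has_vector_derivative_within_subset[OF d[OF c[OF r]]]) auto
    ultimately show "(w \<circ> c has_vector_derivative (t - s) *\<^sub>R w' (c r)) (at r within {0..1})"
      by (rule vector_diff_chain_within)
    have "norm ((t - s) *\<^sub>R w' (c r)) \<le> \<bar>t - s\<bar> * (L * norm (w (c r)) + e)"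
      using b[OF c[OF r]] by (auto intro: mult_left_mono)
    then show "norm ((t - s) *\<^sub>R w' (c r)) \<le> L * \<bar>t - s\<bar> * norm ((w \<circ> c) r) + e * \<bar>t - s\<bar>"
      by (simp add: algebra_simps)
  qed (use L e in auto)
  then show ?thesis by (simp add: c_def)
qed

text \<open>\<open>integral {a..b} f\<close> vanishes for b < a, so the primitive is taken from a
  far left end -N and normalised at 0; by \<open>H_eq\<close> the choice of N may vary with the
  point.\<close>

lemma antiderivative_on_UNIV:
  fixes f :: "real \<Rightarrow> 'a::banach"
  assumes "continuous_on UNIV f"
  shows "\<exists>G. G 0 = x0 \<and> (\<forall>t. (G has_vector_derivative f t) (at t))"
proof -
  define H where "H N u = integral {-N..u} f - integral {-N..0} f" for N u :: real
  have int: "f integrable_on {a..b}" for a b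
    using assms by (intro integrable_continuous_interval) (auto intro: continuous_on_subset)
  have H_eq: "H N u = H M u" if "\<bar>u\<bar> \<le> N" "N \<le> M" for N M u
  proof -
    have "integral {-M..-N} f + integral {-N..u} f = integral {-M..u} f"
      "integral {-M..-N} f + integral {-N..0} f = integral {-M..0} f"
      using that by (auto intro!: Henstock_Kurzweil_Integration.integral_combine int)
    then show ?thesis unfolding H_def by (metis add_diff_cancel_left)
  qed
  have H_deriv: "(H N has_vector_derivative f t) (at t)" if "\<bar>t\<bar> < N" for N t
  proof -
    have "((\<lambda>u. integral {-N..u} f) has_vector_derivative f t) (at t within {-N..N})"
      using that assms by (intro integral_has_vector_derivative) (auto intro: continuous_on_subset)
    then have "((\<lambda>u. integral {-N..u} f) has_vector_derivative f t) (at t)"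
      using that at_within_Icc_at[of "-N" t N] by (simp add: abs_less_iff)
    then show ?thesis unfolding H_def
      by (auto intro!: derivative_eq_intros)
  qed
  define G where "G u = x0 + H (\<bar>u\<bar> + 1) u" for u
  have "(G has_vector_derivative f t) (at t)" for t
  proof -
    have "((\<lambda>u. x0 + H (\<bar>t\<bar> + 2) u) has_vector_derivative f t) (at t)"
      using H_deriv[of t "\<bar>t\<bar> + 2"] by (auto intro!: derivative_eq_intros)
    then show ?thesis
    proof (rule has_vector_derivative_transform_within[where d = 1])
      fix u assume "dist u t < 1"
      then show "x0 + H (\<bar>t\<bar> + 2) u = G u"
        unfolding G_def by (subst H_eq[of u "\<bar>u\<bar> + 1" "\<bar>t\<bar> + 2"]) (auto simp: dist_real_def)
    qed auto
  qed
  moreover have "G 0 = x0" by (simp add: G_def H_def)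
  ultimately show ?thesis by blast
qed

text \<open>Doubling the rate in the weight produces the factor 1/2 upon integration; it becomes the
  contraction constant of the Picard operator. Negative times follow by reflection.\<close>

lemma norm_le_exp_growth:
  fixes D :: "real \<Rightarrow> 'a::real_normed_vector"
  assumes D0: "D 0 = 0"
    and D: "\<And>s. (D has_vector_derivative D' s) (at s)"
    and b: "\<And>s. norm (D' s) \<le> d * K * exp (2 * K * \<bar>s\<bar>)"
    and d: "d \<ge> 0"
  shows "norm (D t) \<le> d / 2 * exp (2 * K * \<bar>t\<bar>)"
proof -
  have *: "norm (E t) \<le> d / 2 * exp (2 * K * t)"
    if E0: "E 0 = 0" and E: "\<And>s. (E has_vector_derivative E' s) (at s)"
      and Eb: "\<And>s. s > 0 \<Longrightarrow> norm (E' s) \<le> d * K * exp (2 * K * s)" and t: "t > 0"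
    for E E' :: "real \<Rightarrow> 'a" and t
  proof -
    have "norm (E t - E 0) \<le> d / 2 * exp (2 * K * t) - d / 2 * exp (2 * K * 0)"
    proof (rule differentiable_bound_general[OF t])
      show "continuous_on {0..t} E"
        using E by (auto intro!: continuous_at_imp_continuous_on has_vector_derivative_continuous)
      show "((\<lambda>s. d / 2 * exp (2 * K * s)) has_vector_derivative d * K * exp (2 * K * s)) (at s)"
        for s by (auto simp flip: has_real_derivative_iff_has_vector_derivative
            intro!: derivative_eq_intros)
    qed (use E Eb in \<open>auto intro!: continuous_intros\<close>)
    then show ?thesis using E0 d by simp
  qed
  consider "t > 0" | "t = 0" | "t < 0" by linarith
  then show ?thesis
  proof cases
    case 1
    then show ?thesis using *[of D D' t] D0 D b by (metis abs_of_pos)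
  next
    case 2
    then show ?thesis using D0 d by simp
  next
    case 3
    have "((\<lambda>s. D (- s)) has_vector_derivative - D' (- s)) (at s)" for s
    proof -
      have "(D \<circ> uminus has_vector_derivative (- 1) *\<^sub>R D' (- s)) (at s)"
        by (rule vector_diff_chain_at[OF _ D]) (auto intro!: derivative_eq_intros)
      then show ?thesis by (simp add: o_def)
    qed
    moreover have "norm (- D' (- s)) \<le> d * K * exp (2 * K * s)" if "s > 0" for s
      using b[of "- s"] that by simp
    ultimately show ?thesis
      using *[of "\<lambda>s. D (- s)" "\<lambda>s. - D' (- s)" "- t"] D0 3 by simp
  qed
qed

text \<open>Banach's fixed point theorem for \<open>v t = exp (- 2 K \<bar>t\<bar>) u t\<close>: this weight makes the
  Picard operator a contraction on the whole time axis.\<close>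

lemma lipschitz_ode_global_solution:
  fixes F :: "'a::euclidean_space \<Rightarrow> 'a"
  assumes lip: "L-lipschitz_on UNIV F" and bdd: "bounded (range F)"
  shows "\<exists>u. u 0 = x0 \<and> (\<forall>t. (u has_vector_derivative F (u t)) (at t))"
proof -
  obtain M where M: "norm (F x) \<le> M" for x
    using bdd by (auto simp: bounded_iff)
  have M0: "M \<ge> 0" using M[of 0] norm_ge_zero order_trans by blast
  \<comment> \<open>\<open>L\<close> may be 0, while the bound \<open>M / K / 2\<close> below needs
    a positive divisor.\<close>
  define K where "K = L + 1"
  have K: "K > 0" and LK: "L \<le> K"
    using lipschitz_on_nonneg[OF lip] by (auto simp: K_def)
  have F_lip: "norm (F x - F y) \<le> K * norm (x - y)" for x y
    using lipschitz_onD[OF lip, of x y] LK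
    by (simp add: dist_norm) (meson mult_right_mono norm_ge_zero order_trans)
  have F_cont: "continuous_on UNIV F" using lip by (rule lipschitz_on_continuous_on)
  define e where "e t = exp (2 * K * \<bar>t\<bar>)" for t
  have e_pos: "e t > 0" for t by (simp add: e_def)
  have e_cont: "continuous_on UNIV e" unfolding e_def by (intro continuous_intros)
  have e1: "1 \<le> e t" for t using K by (simp add: e_def)
  define A where "A v = (SOME G. G 0 = x0 \<and>
      (\<forall>t. (G has_vector_derivative F (e t *\<^sub>R apply_bcontfun v t)) (at t)))"
    for v :: "real \<Rightarrow>\<^sub>C 'a"
  have A: "A v 0 = x0 \<and> (\<forall>t. (A v has_vector_derivative F (e t *\<^sub>R v t)) (at t))" for v
  proof -
    have "continuous_on UNIV (\<lambda>t. F (e t *\<^sub>R v t))"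
      by (rule continuous_on_compose2[OF F_cont]) (auto intro!: continuous_intros e_cont)
    from antiderivative_on_UNIV[OF this] show ?thesis
      unfolding A_def by (rule someI_ex)
  qed
  have A_cont: "continuous_on UNIV (A v)" for v
    using A[of v] by (auto intro!: continuous_at_imp_continuous_on has_vector_derivative_continuous)
  \<comment> \<open>Boundedness of \<open>F\<close> keeps \<open>A v\<close> below a multiple of the
    weight, so the rescaled operator \<open>P\<close> maps bounded functions to bounded
    functions.\<close>
  have A_bound: "norm (A v t - x0) \<le> M / K / 2 * e t" for v t
    unfolding e_def
  proof (rule norm_le_exp_growth[where D = "\<lambda>t. A v t - x0"])
    show "((\<lambda>t. A v t - x0) has_vector_derivative F (e s *\<^sub>R v s)) (at s)" for s
      using A[of v] by (auto intro!: derivative_eq_intros)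
    show "norm (F (e s *\<^sub>R v s)) \<le> M / K * K * exp (2 * K * \<bar>s\<bar>)" for s
    proof -
      have "norm (F (e s *\<^sub>R v s)) \<le> M * 1" using M by simp
      also have "\<dots> \<le> M * exp (2 * K * \<bar>s\<bar>)"
        using M0 e1[of s] by (intro mult_left_mono) (auto simp: e_def)
      finally show ?thesis using K by simp
    qed
  qed (use A[of v] M0 K in auto)
  have A_lip: "norm (A v t - A w t) \<le> dist v w / 2 * e t" for v w t
    unfolding e_def
  proof (rule norm_le_exp_growth[where D = "\<lambda>t. A v t - A w t"])
    show "((\<lambda>t. A v t - A w t) has_vector_derivative F (e s *\<^sub>R v s) - F (e s *\<^sub>R w s)) (at s)" for s
      using A[of v] A[of w] by (auto intro!: derivative_eq_intros)
    show "norm (F (e s *\<^sub>R v s) - F (e s *\<^sub>R w s)) \<le> dist v w * K * exp (2 * K * \<bar>s\<bar>)" for s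
    proof -
      have "norm (F (e s *\<^sub>R v s) - F (e s *\<^sub>R w s)) \<le> K * norm (e s *\<^sub>R v s - e s *\<^sub>R w s)"
        by (rule F_lip)
      also have "\<dots> = K * (e s * dist (v s) (w s))"
        using e_pos[of s] by (simp add: dist_norm flip: scaleR_diff_right)
      also have "\<dots> \<le> K * (e s * dist v w)"
        using K e_pos[of s] dist_bounded[of v s w] by (intro mult_left_mono) auto
      finally show ?thesis by (simp add: e_def mult_ac)
    qed
  qed (use A[of v] A[of w] in auto)
  define P where "P v = Bcontfun (\<lambda>t. (1 / e t) *\<^sub>R A v t)" for v
  have P: "apply_bcontfun (P v) t = (1 / e t) *\<^sub>R A v t" for v t
  proof -
    have "(\<lambda>t. (1 / e t) *\<^sub>R A v t) \<in> bcontfun"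
    proof (rule bcontfun_normI)
      show "continuous_on UNIV (\<lambda>t. (1 / e t) *\<^sub>R A v t)"
        using e_pos by (intro continuous_intros e_cont A_cont) (metis less_irrefl)
      show "norm ((1 / e t) *\<^sub>R A v t) \<le> norm x0 + M / K / 2" for t
      proof -
        have "norm (A v t) \<le> norm x0 + norm (A v t - x0)" by (rule norm_triangle_sub)
        also have "\<dots> \<le> norm x0 * e t + M / K / 2 * e t"
          using A_bound[of v t] e1[of t] mult_left_mono[OF e1[of t], of "norm x0"] by simp
        also have "\<dots> = (norm x0 + M / K / 2) * e t" by (rule distrib_right[symmetric])
        finally have "norm (A v t) / e t \<le> norm x0 + M / K / 2"
          using e_pos[of t] by (simp add: pos_divide_le_eq)
        then show ?thesis using e_pos[of t] by simp
      qed
    qed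
    then show ?thesis unfolding P_def by (simp add: Bcontfun_inverse)
  qed
  have "dist (P v) (P w) \<le> 1 / 2 * dist v w" for v w
  proof (rule dist_bound)
    fix t
    have "dist (P v t) (P w t) = norm (A v t - A w t) / e t"
      using e_pos[of t] by (simp add: P dist_norm divide_inverse mult.commute flip: scaleR_diff_right)
    also have "\<dots> \<le> 1 / 2 * dist v w"
      using A_lip[of v t w] e_pos[of t] by (simp add: divide_simps)
    finally show "dist (P v t) (P w t) \<le> 1 / 2 * dist v w" .
  qed
  then have "\<exists>!v. P v = v"
    by (intro banach_fix_type[of "1 / 2"]) auto
  then obtain v where v: "P v = v" by blast
  have "e t *\<^sub>R v t = A v t" for t
    using P[of v t] e_pos[of t] v by simp
  then show ?thesis using A[of v] by (intro exI[of _ "A v"]) auto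
qed

section \<open>Comparison and uniqueness of solutions\<close>

lemma C1_map_lipschitz_on_cball:
  assumes "C1_map F"
  shows "\<exists>L. L-lipschitz_on (cball 0 R) F"
proof -
  obtain F' where F': "\<And>x. (F has_derivative blinfun_apply (F' x)) (at x)"
    and cont: "continuous_on UNIV F'"
    using assms unfolding C1_map_def by blast
  have "compact (F' ` cball 0 R)"
    using cont by (intro compact_continuous_image) (auto intro: continuous_on_subset)
  then obtain B where B: "\<And>x. x \<in> cball 0 R \<Longrightarrow> norm (F' x) \<le> B"
    by (force dest!: compact_imp_bounded simp: bounded_iff)
  have "dist (F x) (F y) \<le> max B 0 * dist x y" if "x \<in> cball 0 R" "y \<in> cball 0 R" for x y
    unfolding dist_norm
  proof (rule differentiable_bound[of "cball 0 R"])
    show "(F has_derivative blinfun_apply (F' z)) (at z within cball 0 R)" for z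
      using F' by (rule has_derivative_at_withinI)
    show "onorm (blinfun_apply (F' z)) \<le> max B 0" if "z \<in> cball 0 R" for z
      using B[OF that] by (simp add: norm_blinfun.rep_eq)
  qed (use that in auto)
  then show ?thesis by (intro exI lipschitz_onI) auto
qed

lemma ode_solution_on_continuous:
  "ode_solution_on F u I \<Longrightarrow> continuous_on I u"
  unfolding ode_solution_on_def continuous_on_eq_continuous_within
  by (auto intro: has_vector_derivative_continuous)

lemma ode_solution_on_subset:
  "ode_solution_on F u I \<Longrightarrow> J \<subseteq> I \<Longrightarrow> ode_solution_on F u J"
  unfolding ode_solution_on_def by (meson has_vector_derivative_within_subset subsetD)

lemma perturbed_solution_dist:
  fixes F :: "'a::euclidean_space \<Rightarrow> 'a"
  assumes lip: "L-lipschitz_on S F"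
    and u: "ode_solution_on (\<lambda>t. F) u (closed_segment s t)" "u ` closed_segment s t \<subseteq> S"
    and v: "ode_solution_on (\<lambda>t z. F z + h t) v (closed_segment s t)" "v ` closed_segment s t \<subseteq> S"
    and h: "\<And>r. r \<in> closed_segment s t \<Longrightarrow> norm (h r) \<le> e" and e: "e \<ge> 0"
  shows "dist (v t) (u t) \<le> exp (L * \<bar>t - s\<bar> + 1) * (dist (v s) (u s) + e * \<bar>t - s\<bar>)"
  unfolding dist_norm
proof (rule gronwall[where w = "\<lambda>r. v r - u r"])
  fix r assume r: "r \<in> closed_segment s t"
  show "((\<lambda>r. v r - u r) has_vector_derivative F (v r) + h r - F (u r)) (at r within closed_segment s t)"
    using u(1) v(1) r unfolding ode_solution_on_def by (auto intro!: derivative_intros)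
  have "norm (F (v r) - F (u r)) \<le> L * norm (v r - u r)"
    using lipschitz_onD[OF lip, of "v r" "u r"] u(2) v(2) r by (auto simp: dist_norm)
  moreover have "norm (F (v r) + h r - F (u r)) \<le> norm (F (v r) - F (u r)) + norm (h r)"
    by (metis add_diff_eq diff_add_eq norm_triangle_ineq)
  ultimately show "norm (F (v r) + h r - F (u r)) \<le> L * norm (v r - u r) + e"
    using h[OF r] by linarith
qed (use lipschitz_on_nonneg[OF lip] e in auto)

lemma solution_dist:
  fixes F :: "'a::euclidean_space \<Rightarrow> 'a"
  assumes "L-lipschitz_on S F"
    and "ode_solution_on (\<lambda>t. F) u (closed_segment s t)" "u ` closed_segment s t \<subseteq> S"
    and "ode_solution_on (\<lambda>t. F) v (closed_segment s t)" "v ` closed_segment s t \<subseteq> S"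
  shows "dist (v t) (u t) \<le> exp (L * \<bar>t - s\<bar> + 1) * dist (v s) (u s)"
  using perturbed_solution_dist[of L S F u s t "\<lambda>_. 0" v 0] assms by simp

lemma ode_solution_unique:
  fixes F :: "'a::euclidean_space \<Rightarrow> 'a"
  assumes lip: "\<And>R. \<exists>L. L-lipschitz_on (cball 0 R) F"
    and u: "ode_solution_on (\<lambda>t. F) u I" and v: "ode_solution_on (\<lambda>t. F) v I"
    and I: "is_interval I" "s \<in> I" "t \<in> I" and eq: "u s = v s"
  shows "u t = v t"
proof -
  have sub: "closed_segment s t \<subseteq> I"
    using I by (simp add: closed_segment_subset is_interval_convex)
  have "compact (u ` closed_segment s t \<union> v ` closed_segment s t)"
    using u v sub
    by (intro compact_Un compact_continuous_image)
       (auto dest!: ode_solution_on_continuous intro: continuous_on_subset)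
  then obtain R where "u ` closed_segment s t \<union> v ` closed_segment s t \<subseteq> cball 0 R"
    by (metis bounded_subset_ballD compact_imp_bounded ball_subset_cball order_trans)
  moreover obtain L where "L-lipschitz_on (cball 0 R) F" using lip by blast
  ultimately have "dist (v t) (u t) \<le> exp (L * \<bar>t - s\<bar> + 1) * dist (v s) (u s)"
    using ode_solution_on_subset[OF u sub] ode_solution_on_subset[OF v sub]
    by (intro solution_dist) auto
  then show ?thesis using eq by simp
qed

text \<open>The two fields have to agree only along the solution. This allows exchanging
  \<open>F\<close> for a truncated field, and freezing the other components of a coupled system into
  a function of time.\<close>

lemma ode_solution_on_cong:
  assumes u: "ode_solution_on F u I" and eq: "\<And>t. t \<in> I \<Longrightarrow> v t = u t"
    and F: "\<And>t. t \<in> I \<Longrightarrow> G t (u t) = F t (u t)"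
  shows "ode_solution_on G v I"
  unfolding ode_solution_on_def
proof
  fix t assume t: "t \<in> I"
  then have "(u has_vector_derivative F t (u t)) (at t within I)"
    using u unfolding ode_solution_on_def by blast
  then have "(v has_vector_derivative F t (u t)) (at t within I)"
    by (rule has_vector_derivative_transform[OF t, rotated]) (use eq in auto)
  then show "(v has_vector_derivative G t (v t)) (at t within I)"
    using eq[OF t] F[OF t] by simp
qed

section \<open>Truncated fields and maximal solutions\<close>

text \<open>Projection onto a ball is nonexpansive, so composing with it makes the field bounded and
  globally Lipschitz with the same constant; solutions are genuine as long as they stay in the
  ball.\<close>

lemma truncated_solution:
  fixes F :: "'a::euclidean_space \<Rightarrow> 'a"
  assumes lip: "L-lipschitz_on (cball 0 R) F" and R: "R \<ge> 0"
  obtains w where "w 0 = x0"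
    and "ode_solution_on (\<lambda>t z. F (closest_point (cball 0 R) z)) w UNIV"
    and "L-lipschitz_on UNIV (\<lambda>z. F (closest_point (cball 0 R) z))"
    and "\<And>J. w ` J \<subseteq> cball 0 R \<Longrightarrow> ode_solution_on (\<lambda>t. F) w J"
proof -
  define G where "G z = F (closest_point (cball 0 R) z)" for z
  have cp: "closest_point (cball 0 R) z \<in> cball 0 R" for z :: 'a
    using R by (intro closest_point_in_set) auto
  have G_lip: "L-lipschitz_on UNIV G"
  proof (rule lipschitz_onI)
    fix x y :: 'a
    have "dist (G x) (G y) \<le> L * dist (closest_point (cball 0 R) x) (closest_point (cball 0 R) y)"
      unfolding G_def by (rule lipschitz_onD[OF lip cp cp])
    also have "\<dots> \<le> L * dist x y"
      using lipschitz_on_nonneg[OF lip] R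
      by (intro mult_left_mono closest_point_lipschitz) auto
    finally show "dist (G x) (G y) \<le> L * dist x y" .
  qed (rule lipschitz_on_nonneg[OF lip])
  have "bounded (F ` cball 0 R)"
    using lip by (intro compact_imp_bounded compact_continuous_image lipschitz_on_continuous_on) auto
  then have "bounded (range G)"
    by (rule bounded_subset) (use cp in \<open>auto simp: G_def\<close>)
  from lipschitz_ode_global_solution[OF G_lip this] obtain w where
    w: "w 0 = x0" "\<And>t. (w has_vector_derivative G (w t)) (at t)" by blast
  then have sol: "ode_solution_on (\<lambda>t. G) w UNIV"
    unfolding ode_solution_on_def by auto
  show thesis
  proof (rule that[of w])
    show "ode_solution_on (\<lambda>t. F) w J" if "w ` J \<subseteq> cball 0 R" for J
      by (rule ode_solution_on_cong[OF ode_solution_on_subset[OF sol]])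
         (use that in \<open>auto simp: G_def closest_point_self image_subset_iff\<close>)
  qed (use w sol G_lip in \<open>auto simp: G_def[abs_def]\<close>)
qed

lemma open_subset_ode_solution_onI:
  assumes "\<And>t. t \<in> I \<Longrightarrow> \<exists>J. open J \<and> t \<in> J \<and> ode_solution_on F u J"
  shows "ode_solution_on F u I"
  unfolding ode_solution_on_def
proof
  fix t assume "t \<in> I"
  then obtain J where J: "open J" "t \<in> J" "ode_solution_on F u J" using assms by blast
  then have "(u has_vector_derivative F t (u t)) (at t)"
    unfolding ode_solution_on_def by (metis at_within_open)
  then show "(u has_vector_derivative F t (u t)) (at t within I)"
    by (rule has_vector_derivative_at_within)
qed

text \<open>Trajectories are defined as images of maximal solutions, so these have to be produced
  before the center hypothesis can be applied. Uniqueness glues all solutions on open intervals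
  around 0 into one on their union; a truncated solution, which needs some time to leave the ball of
  radius |x0| + 1, shows that there is at least one.\<close>

lemma exists_maximal_solution:
  fixes F :: "'a::euclidean_space \<Rightarrow> 'a"
  assumes lip: "\<And>R. \<exists>L. L-lipschitz_on (cball 0 R) F"
  shows "\<exists>u I. maximal_ode_solution_on (\<lambda>t. F) u I \<and> 0 \<in> I \<and> u 0 = x0"
proof -
  define S where "S = {J. open J \<and> is_interval J \<and> 0 \<in> J \<and>
      (\<exists>v. v 0 = x0 \<and> ode_solution_on (\<lambda>t. F) v J)}"
  define V where "V J = (SOME v. v 0 = x0 \<and> ode_solution_on (\<lambda>t. F) v J)" for J
  have V: "V J 0 = x0 \<and> ode_solution_on (\<lambda>t. F) (V J) J" if "J \<in> S" for J
    using that unfolding S_def V_def mem_Collect_eq by (metis (mono_tags, lifting) someI_ex)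
  define I where "I = \<Union>S"
  define C where "C t = (SOME J. J \<in> S \<and> t \<in> J)" for t
  have C: "C t \<in> S \<and> t \<in> C t" if "t \<in> J" "J \<in> S" for t J
    using someI[of "\<lambda>J. J \<in> S \<and> t \<in> J" J] that unfolding C_def by blast
  define u where "u t = V (C t) t" for t
  have u_eq: "u t = V J t" if J: "J \<in> S" and t: "t \<in> J" for t J
  proof -
    have *: "is_interval (J \<inter> C t)" "0 \<in> J \<inter> C t" "t \<in> J \<inter> C t"
      using C[OF t J] J t by (auto simp: S_def is_interval_Int)
    show ?thesis unfolding u_def
      by (rule ode_solution_unique[OF lip _ _ *])
         (use V[OF J] V[of "C t"] C[OF t J] in \<open>auto intro: ode_solution_on_subset\<close>)
  qed
  have u_sol: "ode_solution_on (\<lambda>t. F) u J" if J: "J \<in> S" for J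
    by (rule ode_solution_on_cong[of "\<lambda>t. F" "V J"]) (use u_eq[OF J] V[OF J] in auto)
  have "ode_solution_on (\<lambda>t. F) u I"
    by (rule open_subset_ode_solution_onI) (use u_sol in \<open>auto simp: I_def S_def\<close>)
  moreover have "open I" unfolding I_def S_def by blast
  moreover have "is_interval I"
    unfolding is_interval_connected_1 I_def
    by (rule connected_Union) (auto simp: S_def is_interval_connected_1)
  moreover obtain J where J: "J \<in> S"
  proof -
    obtain L where L: "L-lipschitz_on (cball 0 (norm x0 + 1)) F" using lip by blast
    obtain w where w: "w 0 = x0" "ode_solution_on (\<lambda>t z. F (closest_point (cball 0 (norm x0 + 1)) z)) w UNIV"
      "\<And>J. w ` J \<subseteq> cball 0 (norm x0 + 1) \<Longrightarrow> ode_solution_on (\<lambda>t. F) w J"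
      by (rule truncated_solution[OF L, of x0]) auto
    have "isCont w 0"
      using ode_solution_on_continuous[OF w(2)] by (simp add: continuous_on_eq_continuous_at)
    then obtain d where d: "d > 0" "\<And>t. dist t 0 < d \<Longrightarrow> dist (w t) x0 < 1"
      unfolding continuous_at_eps_delta using w(1) by (metis zero_less_one)
    have "norm (w t) \<le> norm x0 + 1" if "t \<in> ball 0 d" for t
      using d(2)[of t] that norm_triangle_sub[of "w t" x0] by (simp add: dist_norm norm_minus_commute)
    then have "ode_solution_on (\<lambda>t. F) w (ball 0 d)" by (intro w(3)) auto
    moreover have "is_interval (ball (0::real) d)"
      by (simp add: is_interval_connected_1)
    ultimately show thesis using that[of "ball 0 d"] d w(1) unfolding S_def by auto
  qed
  moreover have "0 \<in> I" using J by (auto simp: I_def S_def)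
  moreover have u0: "u 0 = x0" using u_eq[OF J, of 0] V[OF J] J by (auto simp: S_def)
  moreover have "J = I" if "open J" "is_interval J" "I \<subseteq> J" "ode_solution_on (\<lambda>t. F) v J"
    "\<forall>t\<in>I. v t = u t" for v J
  proof -
    have "J \<in> S" unfolding S_def using that u0 \<open>0 \<in> I\<close> by auto
    then show ?thesis using that(3) by (auto simp: I_def)
  qed
  ultimately show ?thesis unfolding maximal_ode_solution_on_def by blast
qed

text \<open>A globally defined truncated solution \<open>w\<close> agrees with \<open>u\<close> on
  \<open>I\<close>. Since the truncation radius exceeds the bound by 1, \<open>w\<close> is still
  genuine on an open interval containing the closure of \<open>I\<close>. By maximality that
  interval is \<open>I\<close>, so \<open>I\<close> is both open and closed.\<close>

lemma maximal_solution_bounded_UNIV: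
  fixes F :: "'a::euclidean_space \<Rightarrow> 'a"
  assumes lip: "\<And>R. \<exists>L. L-lipschitz_on (cball 0 R) F"
    and max: "maximal_ode_solution_on (\<lambda>t. F) u I" and "0 \<in> I"
    and bdd: "bounded (u ` I)"
  shows "I = UNIV"
proof -
  have I: "open I" "is_interval I" "ode_solution_on (\<lambda>t. F) u I"
    and I_max: "\<And>v J. open J \<Longrightarrow> is_interval J \<Longrightarrow> I \<subseteq> J \<Longrightarrow> ode_solution_on (\<lambda>t. F) v J \<Longrightarrow>
      \<forall>t\<in>I. v t = u t \<Longrightarrow> J = I"
    using max unfolding maximal_ode_solution_on_def by blast+
  obtain R where R: "R > 0" "\<And>t. t \<in> I \<Longrightarrow> norm (u t) \<le> R"
    using bdd unfolding bounded_pos by auto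
  obtain L where L: "L-lipschitz_on (cball 0 (R + 1)) F" using lip by blast
  obtain w where w: "w 0 = u 0"
    "ode_solution_on (\<lambda>t z. F (closest_point (cball 0 (R + 1)) z)) w UNIV"
    "L-lipschitz_on UNIV (\<lambda>z. F (closest_point (cball 0 (R + 1)) z))"
    "\<And>J. w ` J \<subseteq> cball 0 (R + 1) \<Longrightarrow> ode_solution_on (\<lambda>t. F) w J"
    by (rule truncated_solution[OF L, of "u 0"]) (use R in auto)
  have w_cont: "continuous_on UNIV w" using w(2) by (rule ode_solution_on_continuous)
  have w_eq: "w t = u t" if "t \<in> I" for t
  proof (rule ode_solution_unique[OF _ _ _ I(2) \<open>0 \<in> I\<close> that])
    show "ode_solution_on (\<lambda>t z. F (closest_point (cball 0 (R + 1)) z)) u I"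
      by (rule ode_solution_on_cong[OF I(3)])
         (use R in \<open>force simp: closest_point_self\<close>)+
    show "\<exists>L. L-lipschitz_on (cball 0 R') (\<lambda>z. F (closest_point (cball 0 (R + 1)) z))" for R'
      using w(3) by (blast intro: lipschitz_on_subset)
  qed (use w(1) ode_solution_on_subset[OF w(2)] in auto)
  define O' where "O' = {t. norm (w t) < R + 1}"
  have O': "open O'" unfolding O'_def
    by (intro open_Collect_less continuous_intros w_cont)
  have "closed {t. norm (w t) \<le> R}"
    by (intro closed_Collect_le continuous_intros w_cont)
  then have "closure I \<subseteq> {t. norm (w t) \<le> R}"
    using R w_eq by (intro closure_minimal) auto
  then have cl: "closure I \<subseteq> O'" unfolding O'_def by force
  define J where "J = connected_component_set O' 0"
  have JO: "J \<subseteq> O'" unfolding J_def by (rule connected_component_subset)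
  have clJ: "closure I \<subseteq> J" unfolding J_def
    using cl I(2) \<open>0 \<in> I\<close> closure_subset
    by (intro connected_component_maximal connected_imp_connected_closure)
       (auto simp: is_interval_connected_1)
  have "J = I"
  proof (rule I_max)
    show "open J" unfolding J_def using O' by (rule open_connected_component)
    show "is_interval J" unfolding J_def by (simp add: is_interval_connected_1)
    show "I \<subseteq> J" using clJ closure_subset by blast
    show "ode_solution_on (\<lambda>t. F) w J"
      by (rule w(4)) (use JO in \<open>force simp: O'_def\<close>)
  qed (use w_eq in auto)
  then have "closed I" using clJ closure_subset_eq by blast
  then show ?thesis using I(1) clopen \<open>0 \<in> I\<close> by blast
qed

subsection \<open>Flows with compact orbits\<close>

lemma exists_compact_global_solution:
  fixes F :: "'a::euclidean_space \<Rightarrow> 'a"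
  assumes lip: "\<And>R. \<exists>L. L-lipschitz_on (cball 0 R) F"
    and cpt: "\<And>C. trajectory F C \<Longrightarrow> compact C"
  shows "\<exists>u. u 0 = x0 \<and> ode_solution_on (\<lambda>t. F) u UNIV \<and> compact (range u)"
proof -
  obtain u I where u: "maximal_ode_solution_on (\<lambda>t. F) u I" "0 \<in> I" "u 0 = x0"
    using exists_maximal_solution[OF lip] by blast
  then have c: "compact (u ` I)"
    using cpt unfolding trajectory_def by blast
  have "I = UNIV"
    using maximal_solution_bounded_UNIV[OF lip u(1,2)] c compact_imp_bounded by blast
  then show ?thesis using u c unfolding maximal_ode_solution_on_def by blast
qed

lemma global_center_compact_trajectory:
  assumes "global_center F" "trajectory F C"
  shows "compact C"
proof (cases "C = {0}")
  case False
  then obtain c where "simple_path c" "path_image c = C"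
    using assms unfolding global_center_def closed_curve_def by blast
  then show ?thesis using compact_simple_path_image by blast
qed simp

text \<open>The flow is assumed solution by solution: dependence on the initial point is derived
  from \<open>lip\<close>, and periodicity from the compactness of orbits. The dimension is left
  open; the plane enters only in the study of the return map.\<close>

locale compact_orbit_flow =
  fixes F :: "'a::euclidean_space \<Rightarrow> 'a" and \<phi> :: "real \<Rightarrow> 'a \<Rightarrow> 'a"
  assumes lip: "\<And>R. \<exists>L. L-lipschitz_on (cball 0 R) F"
    and flow_0 [simp]: "\<phi> 0 x = x"
    and flow_solution: "ode_solution_on (\<lambda>t. F) (\<lambda>t. \<phi> t x) UNIV"
    and compact_orbit: "compact (range (\<lambda>t. \<phi> t x))"
begin

lemma flow_deriv: "((\<lambda>t. \<phi> t x) has_vector_derivative F (\<phi> t x)) (at t)"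
  using flow_solution[of x] by (simp add: ode_solution_on_def)

lemma flow_shift_solution: "ode_solution_on (\<lambda>t. F) (\<lambda>t. \<phi> (t + s) x) UNIV"
proof -
  have "((\<lambda>t. \<phi> t x) \<circ> (\<lambda>t. t + s) has_vector_derivative 1 *\<^sub>R F (\<phi> (t + s) x)) (at t)" for t
    by (rule vector_diff_chain_at[OF _ flow_deriv]) (auto intro!: derivative_eq_intros)
  then show ?thesis by (simp add: ode_solution_on_def o_def)
qed

lemma flow_unique:
  assumes "ode_solution_on (\<lambda>t. F) u I" "is_interval I" "0 \<in> I" "t \<in> I" "u 0 = x"
  shows "u t = \<phi> t x"
  by (rule ode_solution_unique[OF lip assms(1) _ assms(2-4)])
     (use assms(5) ode_solution_on_subset[OF flow_solution] in auto)

lemma flow_add: "\<phi> (s + t) x = \<phi> s (\<phi> t x)"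
  by (rule flow_unique[OF flow_shift_solution]) auto

lemma flow_minus [simp]: "\<phi> (- t) (\<phi> t x) = x" "\<phi> t (\<phi> (- t) x) = x"
  by (simp_all flip: flow_add)

lemma flow_continuous_time: "continuous_on S (\<lambda>t. \<phi> t x)"
  using ode_solution_on_continuous[OF flow_solution] continuous_on_subset by blast

lemma F_continuous: "continuous_on UNIV F"
proof -
  have "isCont F x" for x
  proof -
    obtain L where "L-lipschitz_on (cball 0 (norm x + 1)) F" using lip by blast
    moreover have "ball x 1 \<subseteq> cball 0 (norm x + 1)"
      by (rule subsetI)
         (metis add.commute add_left_mono dist_norm less_imp_le mem_ball mem_cball_0
            norm_minus_commute norm_triangle_sub order_trans)
    ultimately have "continuous_on (ball x 1) F"
      using lipschitz_on_continuous_on lipschitz_on_subset by blast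
    then show ?thesis by (simp add: continuous_on_eq_continuous_at)
  qed
  then show ?thesis by (simp add: continuous_at_imp_continuous_on)
qed

text \<open>The orbit of \<open>z\<close> lies in one ball, so a single Lipschitz constant of
  \<open>F\<close> serves all of it and \<open>d\<close>, \<open>C\<close>, \<open>R\<close> do not
  depend on \<open>s\<close>. Gronwall's inequality presupposes that both solutions stay in the
  ball, which is not known for \<open>w\<close>; hence it is first applied to the truncated field.
  Radius \<open>1 / C\<close> keeps the deviation at most 1, the margin between \<open>R0\<close>
  and \<open>R\<close>, so the truncated solution is the flow.\<close>

lemma flow_lipschitz_near_orbit:
  "\<exists>d>0. \<exists>C\<ge>1. \<exists>R. \<forall>s. \<forall>w\<in>ball (\<phi> s z) d. \<forall>w'\<in>ball (\<phi> s z) d. \<forall>t. \<bar>t\<bar> \<le> b \<longrightarrow>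
     norm (\<phi> t w) \<le> R \<and> dist (\<phi> t w) (\<phi> t w') \<le> C * dist w w'"
proof -
  obtain R0 where R0: "R0 > 0" "\<And>t. norm (\<phi> t z) \<le> R0"
    using compact_orbit[of z, THEN compact_imp_bounded] unfolding bounded_pos by auto
  define R where "R = R0 + 1"
  obtain L where L: "L-lipschitz_on (cball 0 R) F" using lip by blast
  define C where "C = exp (L * \<bar>b\<bar> + 1)"
  have L0: "L \<ge> 0" using L by (rule lipschitz_on_nonneg)
  have C1: "C \<ge> 1" unfolding C_def using L0 by simp
  have C: "exp (L * \<bar>t - 0\<bar> + 1) \<le> C" if "\<bar>t\<bar> \<le> b" for t
    unfolding C_def using that L0 by (auto intro: mult_left_mono)
  have stay: "norm (\<phi> t w) \<le> R" if w: "w \<in> ball (\<phi> s z) (1 / C)" and t: "\<bar>t\<bar> \<le> b" for w s t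
  proof -
    define G where "G y = F (closest_point (cball 0 R) y)" for y
    obtain W where W: "W 0 = w" "ode_solution_on (\<lambda>t. G) W UNIV" "L-lipschitz_on UNIV G"
      "\<And>J. W ` J \<subseteq> cball 0 R \<Longrightarrow> ode_solution_on (\<lambda>t. F) W J"
      by (rule truncated_solution[OF L, of w]) (use R0 in \<open>auto simp: R_def G_def[abs_def]\<close>)
    have sol: "ode_solution_on (\<lambda>t. G) (\<lambda>r. \<phi> (r + s) z) UNIV"
      by (rule ode_solution_on_cong[OF flow_shift_solution])
         (use R0 in \<open>auto simp: G_def R_def closest_point_self add_increasing2\<close>)
    have bound: "W r \<in> cball 0 R" if r: "\<bar>r\<bar> \<le> b" for r
    proof -
      have "dist (W r) (\<phi> (r + s) z) \<le> exp (L * \<bar>r - 0\<bar> + 1) * dist (W 0) (\<phi> (0 + s) z)"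
        by (rule solution_dist[OF W(3)]) (use W(2) sol in \<open>auto intro: ode_solution_on_subset\<close>)
      also have "\<dots> \<le> C * dist w (\<phi> s z)"
        using C[OF r] W(1) by (auto intro: mult_right_mono)
      also have "\<dots> \<le> 1"
        using w C1 by (simp add: dist_commute field_simps)
      finally show ?thesis
        using R0(2)[of "r + s"] norm_triangle_sub[of "W r" "\<phi> (r + s) z"]
        by (auto simp: R_def dist_norm)
    qed
    have "ode_solution_on (\<lambda>t. F) W {-b..b}"
      by (rule W(4)) (use bound in force)
    then have "W t = \<phi> t w"
      by (rule flow_unique) (use t W(1) in \<open>auto simp: is_interval_cc\<close>)
    then show ?thesis using bound[OF t] by simp
  qed
  have "dist (\<phi> t w) (\<phi> t w') \<le> C * dist w w'"
    if w: "w \<in> ball (\<phi> s z) (1 / C)" "w' \<in> ball (\<phi> s z) (1 / C)" and t: "\<bar>t\<bar> \<le> b" for w w' s t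
  proof -
    have seg: "\<bar>r\<bar> \<le> b" if "r \<in> closed_segment 0 t" for r
      using that t by (auto simp: closed_segment_eq_real_ivl split: if_splits)
    have "dist (\<phi> t w) (\<phi> t w') \<le> exp (L * \<bar>t - 0\<bar> + 1) * dist (\<phi> 0 w) (\<phi> 0 w')"
      by (rule solution_dist[OF L])
         (use stay w seg ode_solution_on_subset[OF flow_solution] in \<open>auto simp: image_subset_iff\<close>)
    also have "\<dots> \<le> C * dist w w'"
      using C[OF t] by (auto intro: mult_right_mono)
    finally show ?thesis .
  qed
  with stay C1 show ?thesis
    by (intro exI[of _ "1 / C"] conjI exI[of _ C] exI[of _ R]) auto
qed

lemma flow_continuous_space: "continuous_on S (\<phi> t)"
proof -
  have "isCont (\<phi> t) z" for z
  proof -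
    obtain d C where d: "d > 0" "C \<ge> 1" and *: "\<And>w. w \<in> ball z d \<Longrightarrow> dist (\<phi> t w) (\<phi> t z) \<le> C * dist w z"
      using flow_lipschitz_near_orbit[of z "\<bar>t\<bar>"] by (metis centre_in_ball flow_0 order_refl)
    have "((\<lambda>w. dist (\<phi> t w) (\<phi> t z)) \<longlongrightarrow> 0) (at z)"
    proof (rule Lim_null_comparison)
      show "\<forall>\<^sub>F w in at z. norm (dist (\<phi> t w) (\<phi> t z)) \<le> C * dist w z"
        using d * by (auto simp: eventually_at dist_commute intro!: exI[of _ d])
      show "((\<lambda>w. C * dist w z) \<longlongrightarrow> 0) (at z)"
        by (auto intro!: tendsto_eq_intros)
    qed
    then show ?thesis unfolding isCont_def by (subst tendsto_dist_iff)
  qed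
  then show ?thesis by (simp add: continuous_at_imp_continuous_on)
qed

text \<open>If \<open>t \<mapsto> \<phi> t x\<close> is injective, Baire's theorem yields an arc of the compact orbit with nonempty
  relative interior; finitely many of its translates along the flow cover the whole orbit.\<close>

lemma periodic: "\<exists>T>0. \<phi> T x = x"
proof (rule ccontr)
  assume not_per: "\<not> (\<exists>T>0. \<phi> T x = x)"
  have inj: "\<not> t > s" if "\<phi> t x = \<phi> s x" for s t
  proof
    assume "t > s"
    have "\<phi> (t - s) x = \<phi> (- s) (\<phi> t x)" by (simp flip: flow_add)
    also have "\<dots> = x" using that by simp
    finally show False using not_per \<open>t > s\<close> by (meson diff_gt_0_iff_gt)
  qed
  define C where "C = range (\<lambda>t. \<phi> t x)"
  have C: "compact C" unfolding C_def by (rule compact_orbit)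
  define K where "K n = (\<lambda>t. \<phi> t x) ` {- real n..real n}" for n :: nat
  have K: "compact (K n)" for n
    unfolding K_def by (intro compact_continuous_image flow_continuous_time) auto
  have "\<exists>n. \<not> C \<subseteq> closure (C - K n)"
  proof (rule ccontr)
    assume dense: "\<not> (\<exists>n. \<not> C \<subseteq> closure (C - K n))"
    have "C \<subseteq> closure (\<Inter>n. C - K n)"
    proof (intro Baire)
      show "openin (top_of_set C) T \<and> C \<subseteq> closure T" if "T \<in> range (\<lambda>n. C - K n)" for T
        using that dense compact_imp_closed[OF K]
        by (auto simp: Diff_eq intro!: openin_open_Int)
    qed (use C compact_imp_closed in auto)
    moreover have "\<phi> t x \<in> K (nat \<lceil>\<bar>t\<bar>\<rceil>)" for t
      unfolding K_def by (rule imageI) (auto, linarith+)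
    then have "(\<Inter>n. C - K n) = {}" unfolding C_def by blast
    ultimately have "C \<subseteq> {}" by (metis closure_empty)
    then show False by (simp add: C_def)
  qed
  then obtain n c where c: "c \<in> C" "c \<notin> closure (C - K n)" by blast
  define V where "V = - closure (C - K n)"
  have V: "open V" "c \<in> V" "V \<inter> C \<subseteq> K n"
    using c closure_subset[of "C - K n"] by (auto simp: V_def)
  obtain s where s: "c = \<phi> s x" using c(1) by (auto simp: C_def)
  define W where "W r = \<phi> r -` V" for r
  have "open (W r)" for r
    unfolding W_def using V(1) flow_continuous_space by (intro open_vimage) auto
  moreover have "C \<subseteq> (\<Union>r\<in>UNIV. W r)"
  proof
    fix y assume "y \<in> C"
    then obtain t where "y = \<phi> t x" by (auto simp: C_def)
    then have "\<phi> (s - t) y = c" by (simp add: s flip: flow_add)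
    then show "y \<in> (\<Union>r\<in>UNIV. W r)" using V(2) by (auto simp: W_def)
  qed
  ultimately obtain D where D: "finite D" "C \<subseteq> (\<Union>r\<in>D. W r)"
    using compactE_image[OF C, of UNIV W] by metis
  \<comment> \<open>Some shift r in \<open>D\<close> moves the point at time M + 1 into
    \<open>V\<close>, hence onto the arc \<open>K n\<close>. The sum of all |r| ensures that its
    time r + M + 1 still exceeds \<open>n\<close>, against injectivity.\<close>
  define M where "M = real n + (\<Sum>r\<in>D. \<bar>r\<bar>)"
  have "\<phi> (M + 1) x \<in> C" by (auto simp: C_def)
  then obtain r where r: "r \<in> D" "\<phi> (r + (M + 1)) x \<in> V" using D(2) by (auto simp: W_def flow_add)
  then have "\<phi> (r + (M + 1)) x \<in> K n" using V(3) by (auto simp: C_def)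
  then obtain q where q: "q \<le> real n" "\<phi> (r + (M + 1)) x = \<phi> q x"
    unfolding K_def by auto
  have "\<bar>r\<bar> \<le> (\<Sum>r\<in>D. \<bar>r\<bar>)" using r D by (auto intro: member_le_sum)
  then have "r + (M + 1) > q" using q unfolding M_def by linarith
  then show False using inj[OF q(2)] by simp
qed

lemma flow_periods:
  assumes "\<phi> T x = x"
  shows "\<phi> (of_int n * T) x = x"
proof -
  have nat: "\<phi> (real m * T) x = x" for m
    by (induction m) (use assms in \<open>auto simp: distrib_right flow_add\<close>)
  show ?thesis
  proof (cases n)
    case (nonneg m)
    then show ?thesis using nat by simp
  next
    case (neg m)
    then show ?thesis using nat[of "Suc m"] by (metis flow_minus(1) minus_mult_left of_int_minus of_int_of_nat_eq)
  qed
qed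

lemma period_reduction:
  assumes "T > 0" "\<phi> T x = x"
  obtains n :: int and r where "r \<in> {0..T}" "t = of_int n * T + r" "\<phi> t x = \<phi> r x"
proof
  have "of_int \<lfloor>t / T\<rfloor> * T \<le> t / T * T" "t / T * T \<le> (of_int \<lfloor>t / T\<rfloor> + 1) * T"
    using assms(1) floor_correct[of "t / T"] by (intro mult_right_mono; simp)+
  then show "t - of_int \<lfloor>t / T\<rfloor> * T \<in> {0..T}" using assms(1) by (simp add: algebra_simps)
  show t: "t = of_int \<lfloor>t / T\<rfloor> * T + (t - of_int \<lfloor>t / T\<rfloor> * T)" by simp
  have "\<phi> ((t - of_int \<lfloor>t / T\<rfloor> * T) + of_int \<lfloor>t / T\<rfloor> * T) x = \<phi> (t - of_int \<lfloor>t / T\<rfloor> * T) x"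
    by (subst flow_add) (simp only: flow_periods[OF assms(2)])
  then show "\<phi> t x = \<phi> (t - of_int \<lfloor>t / T\<rfloor> * T) x" by simp
qed

end

lemma exists_compact_orbit_flow:
  assumes "C1_map F" and "global_center F"
  shows "\<exists>\<phi>. compact_orbit_flow F \<phi>"
proof -
  have lip: "\<exists>L. L-lipschitz_on (cball 0 R) F" for R
    using assms(1) by (rule C1_map_lipschitz_on_cball)
  have "\<forall>x. \<exists>u. u 0 = x \<and> ode_solution_on (\<lambda>t. F) u UNIV \<and> compact (range u)"
    using exists_compact_global_solution[OF lip] global_center_compact_trajectory[OF assms(2)]
    by blast
  then obtain u where "\<And>x. u x 0 = x \<and> ode_solution_on (\<lambda>t. F) (u x) UNIV \<and> compact (range (u x))"
    by metis
  then have "compact_orbit_flow F (\<lambda>t x. u x t)"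
    by unfold_locales (use lip in auto)
  then show ?thesis by blast
qed

subsection \<open>Return to a section\<close>

context compact_orbit_flow
begin

lemma flow_continuous:
  fixes h :: "'b::metric_space \<Rightarrow> real"
  assumes h: "continuous_on A h" and y: "continuous_on A y"
  shows "continuous_on A (\<lambda>a. \<phi> (h a) (y a))"
  unfolding continuous_on_eq_continuous_within continuous_within tendsto_dist_iff[of _ "\<phi> _ _"]
proof
  fix a assume a: "a \<in> A"
  obtain d C where d: "d > 0" "C \<ge> 1" and
    C: "\<And>w t. w \<in> ball (y a) d \<Longrightarrow> \<bar>t\<bar> \<le> \<bar>h a\<bar> + 1 \<Longrightarrow> dist (\<phi> t w) (\<phi> t (y a)) \<le> C * dist w (y a)"
    using flow_lipschitz_near_orbit[of "y a" "\<bar>h a\<bar> + 1"] by (metis flow_0 centre_in_ball)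
  have h': "(h \<longlongrightarrow> h a) (at a within A)" and y': "(y \<longlongrightarrow> y a) (at a within A)"
    using h y a by (auto simp: continuous_on_def)
  show "((\<lambda>b. dist (\<phi> (h b) (y b)) (\<phi> (h a) (y a))) \<longlongrightarrow> 0) (at a within A)"
  proof (rule Lim_null_comparison)
    have "\<forall>\<^sub>F b in at a within A. dist (y b) (y a) < d"
      using y' d(1) by (rule tendstoD)
    moreover have "\<forall>\<^sub>F b in at a within A. dist (h b) (h a) < 1"
      using h' zero_less_one by (rule tendstoD)
    ultimately show "\<forall>\<^sub>F b in at a within A. norm (dist (\<phi> (h b) (y b)) (\<phi> (h a) (y a))) \<le>
        C * dist (y b) (y a) + dist (\<phi> (h b) (y a)) (\<phi> (h a) (y a))"
    proof eventually_elim
      case (elim b)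
      have "dist (\<phi> (h b) (y b)) (\<phi> (h b) (y a)) \<le> C * dist (y b) (y a)"
        using elim by (intro C) (auto simp: dist_commute dist_real_def)
      then show ?case
        using dist_triangle[of "\<phi> (h b) (y b)" "\<phi> (h a) (y a)" "\<phi> (h b) (y a)"] by simp
    qed
    have "isCont (\<lambda>t. \<phi> t (y a)) (h a)"
      using flow_continuous_time[of UNIV] by (simp add: continuous_on_eq_continuous_at)
    then have "((\<lambda>b. \<phi> (h b) (y a)) \<longlongrightarrow> \<phi> (h a) (y a)) (at a within A)"
      using h' by (rule isCont_tendsto_compose)
    from tendsto_add[OF tendsto_mult_right_zero[OF y'[unfolded tendsto_dist_iff[of y]]]
        this[unfolded tendsto_dist_iff[of "\<lambda>b. \<phi> (h b) (y a)"]]]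
    show "((\<lambda>b. C * dist (y b) (y a) + dist (\<phi> (h b) (y a)) (\<phi> (h a) (y a))) \<longlongrightarrow> 0) (at a within A)"
      by simp
  qed
qed

text \<open>The coordinate in direction \<open>F z\<close> grows at rate at least
  \<open>\<kappa>\<close> along the flow near \<open>z\<close>, so every nearby orbit crosses the
  section through \<open>z\<close> orthogonal to \<open>F z\<close>, at time
  \<open>\<theta> w\<close>. The same rate compares the crossing times of two points with the
  distance of their orbits. This takes the place of the implicit function theorem, which would ask
  for a differentiable flow.\<close>

lemma flow_box:
  assumes "F z \<noteq> 0"
  obtains r \<tau> \<kappa> \<theta> B where "r > 0" "\<tau> > 0" "\<kappa> > 0"
    and "\<And>w s t. w \<in> ball z r \<Longrightarrow> - \<tau> \<le> s \<Longrightarrow> s \<le> t \<Longrightarrow> t \<le> \<tau> \<Longrightarrow>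
      \<kappa> * (t - s) \<le> (\<phi> t w - \<phi> s w) \<bullet> F z"
    and "\<And>w. w \<in> ball z r \<Longrightarrow> \<bar>\<theta> w\<bar> \<le> \<tau> \<and> (\<phi> (\<theta> w) w - z) \<bullet> F z = 0"
    and "B-lipschitz_on (ball z r) \<theta>" and "\<theta> z = 0"
proof -
  define v where "v = F z"
  have v: "norm v > 0" using assms by (simp add: v_def)
  define \<kappa> where "\<kappa> = v \<bullet> v / 2"
  have \<kappa>: "\<kappa> > 0" using v by (simp add: \<kappa>_def)
  have "isCont F z" using F_continuous by (simp add: continuous_on_eq_continuous_at)
  then obtain d1 where d1: "d1 > 0" "\<And>y. dist y z < d1 \<Longrightarrow> dist (F y) v < norm v / 2"
    unfolding continuous_at_eps_delta v_def using assms by (metis half_gt_zero zero_less_norm_iff)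
  have speed: "\<kappa> \<le> F y \<bullet> v" if "dist y z < d1" for y
  proof -
    have "(v - F y) \<bullet> v \<le> norm (v - F y) * norm v" by (rule norm_cauchy_schwarz)
    also have "\<dots> \<le> norm v / 2 * norm v"
      using d1(2)[OF that] by (intro mult_right_mono) (auto simp: dist_norm norm_minus_commute)
    also have "\<dots> = \<kappa>" by (simp add: \<kappa>_def dot_square_norm power2_eq_square)
    finally show ?thesis by (simp add: \<kappa>_def inner_diff_left)
  qed
  obtain d C where d: "d > 0" "C \<ge> 1" and
    C: "\<And>w w' t. w \<in> ball z d \<Longrightarrow> w' \<in> ball z d \<Longrightarrow> \<bar>t\<bar> \<le> 1 \<Longrightarrow> dist (\<phi> t w) (\<phi> t w') \<le> C * dist w w'"
    using flow_lipschitz_near_orbit[of z 1] by (metis flow_0)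
  have "isCont (\<lambda>t. \<phi> t z) 0"
    using flow_continuous_time[of UNIV] by (simp add: continuous_on_eq_continuous_at)
  then obtain d2 where d2: "d2 > 0" "\<And>t. dist t 0 < d2 \<Longrightarrow> dist (\<phi> t z) z < d1 / 2"
    unfolding continuous_at_eps_delta using d1(1) by (metis half_gt_zero flow_0)
  define \<tau> where "\<tau> = min 1 (d2 / 2)"
  have \<tau>: "\<tau> > 0" "\<tau> \<le> 1" "\<tau> < d2" using d2(1) by (auto simp: \<tau>_def)
  \<comment> \<open>The first two bounds keep the orbit pieces where the speed estimate holds; the
    third keeps the initial coordinate within \<open>\<kappa> * \<tau>\<close>, so that it changes
    sign during the times from -\<tau> to \<tau>.\<close>
  define r where "r = min (min d (d1 / (2 * C))) (\<kappa> * \<tau> / norm v)"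
  have r: "r > 0" "r \<le> d" "r \<le> d1 / (2 * C)" "r \<le> \<kappa> * \<tau> / norm v"
    using d d1 \<kappa> \<tau> v by (auto simp: r_def)
  have near: "dist (\<phi> t w) z < d1" if w: "w \<in> ball z r" and t: "\<bar>t\<bar> \<le> \<tau>" for w t
  proof -
    have "dist (\<phi> t w) (\<phi> t z) \<le> C * dist w z" using w t r \<tau> d by (intro C) auto
    also have "\<dots> < C * (d1 / (2 * C))"
      using w r d by (intro mult_strict_left_mono) (auto simp: dist_commute)
    also have "\<dots> = d1 / 2" using d by simp
    finally have "dist (\<phi> t w) (\<phi> t z) < d1 / 2" .
    moreover have "dist (\<phi> t z) z < d1 / 2" using t \<tau> by (intro d2) auto
    ultimately show ?thesis using dist_triangle[of "\<phi> t w" z "\<phi> t z"] by linarith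
  qed
  have mono: "\<kappa> * (t - s) \<le> (\<phi> t w - \<phi> s w) \<bullet> v"
    if w: "w \<in> ball z r" and st: "- \<tau> \<le> s" "s \<le> t" "t \<le> \<tau>" for w s t
  proof -
    have "\<phi> s w \<bullet> v - \<kappa> * s \<le> \<phi> t w \<bullet> v - \<kappa> * t"
    proof (rule DERIV_nonneg_imp_nondecreasing[OF st(2)])
      fix x assume x: "s \<le> x" "x \<le> t"
      have "((\<lambda>a. \<phi> a w \<bullet> v - \<kappa> * a) has_real_derivative F (\<phi> x w) \<bullet> v - \<kappa>) (at x)"
        using flow_deriv[of w x]
        by (auto simp: has_real_derivative_iff_has_vector_derivative has_vector_derivative_def
            intro!: derivative_eq_intros) (simp add: algebra_simps)
      moreover have "0 \<le> F (\<phi> x w) \<bullet> v - \<kappa>"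
        using speed[OF near[OF w, of x]] x st by auto
      ultimately show "\<exists>y. ((\<lambda>a. \<phi> a w \<bullet> v - \<kappa> * a) has_real_derivative y) (at x) \<and> 0 \<le> y"
        by blast
    qed
    then show ?thesis by (simp add: inner_diff_left algebra_simps)
  qed
  have ex: "\<exists>t. \<bar>t\<bar> \<le> \<tau> \<and> (\<phi> t w - z) \<bullet> v = 0" if w: "w \<in> ball z r" for w
  proof -
    have "\<bar>(w - z) \<bullet> v\<bar> \<le> norm (w - z) * norm v" by (rule Cauchy_Schwarz_ineq2)
    also have "\<dots> \<le> \<kappa> * \<tau> / norm v * norm v"
      using w r by (intro mult_right_mono) (auto simp: dist_norm norm_minus_commute)
    also have "\<dots> = \<kappa> * \<tau>" using v by simp
    finally have *: "\<bar>(w - z) \<bullet> v\<bar> \<le> \<kappa> * \<tau>" .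
    have "(\<phi> (- \<tau>) w - z) \<bullet> v \<le> 0" "0 \<le> (\<phi> \<tau> w - z) \<bullet> v"
      using mono[OF w, of "- \<tau>" 0] mono[OF w, of 0 \<tau>] * \<tau> by (auto simp: inner_diff_left)
    moreover have "continuous_on {- \<tau>..\<tau>} (\<lambda>t. (\<phi> t w - z) \<bullet> v)"
      by (intro continuous_intros flow_continuous_time)
    ultimately obtain t where "- \<tau> \<le> t" "t \<le> \<tau>" "(\<phi> t w - z) \<bullet> v = 0"
      using IVT'[of "\<lambda>t. (\<phi> t w - z) \<bullet> v" "- \<tau>" 0 \<tau>] \<tau> by auto
    then show ?thesis by (intro exI[of _ t]) auto
  qed
  define \<theta> where "\<theta> w = (SOME t. \<bar>t\<bar> \<le> \<tau> \<and> (\<phi> t w - z) \<bullet> v = 0)" for w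
  have \<theta>: "\<bar>\<theta> w\<bar> \<le> \<tau> \<and> (\<phi> (\<theta> w) w - z) \<bullet> v = 0" if "w \<in> ball z r" for w
    unfolding \<theta>_def using ex[OF that] by (rule someI_ex)
  have abs_mono: "\<kappa> * \<bar>t - s\<bar> \<le> \<bar>(\<phi> t w - \<phi> s w) \<bullet> v\<bar>"
    if w: "w \<in> ball z r" and st: "\<bar>s\<bar> \<le> \<tau>" "\<bar>t\<bar> \<le> \<tau>" for w s t
    using mono[OF w, of s t] mono[OF w, of t s] st
    by (cases "s \<le> t") (auto simp: inner_diff_left abs_le_iff)
  have "(norm v * C / \<kappa>)-lipschitz_on (ball z r) \<theta>"
  proof (rule lipschitz_onI)
    fix w w' assume w: "w \<in> ball z r" "w' \<in> ball z r"
    have "\<kappa> * \<bar>\<theta> w - \<theta> w'\<bar> \<le> \<bar>(\<phi> (\<theta> w) w - \<phi> (\<theta> w') w) \<bullet> v\<bar>"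
      using w \<theta> by (intro abs_mono) auto
    also have "\<dots> = \<bar>(\<phi> (\<theta> w') w' - \<phi> (\<theta> w') w) \<bullet> v\<bar>"
      using \<theta>[OF w(1)] \<theta>[OF w(2)] by (simp add: inner_diff_left)
    also have "\<dots> \<le> norm (\<phi> (\<theta> w') w' - \<phi> (\<theta> w') w) * norm v"
      by (rule Cauchy_Schwarz_ineq2)
    also have "\<dots> \<le> (C * dist w' w) * norm v"
      using w \<theta>[OF w(2)] r \<tau> by (intro mult_right_mono) (auto simp flip: dist_norm intro!: C)
    finally show "dist (\<theta> w) (\<theta> w') \<le> norm v * C / \<kappa> * dist w w'"
      using \<kappa> by (simp add: dist_real_def dist_commute field_simps)
  qed (use \<kappa> v d in auto)
  moreover have "\<theta> z = 0"
    using abs_mono[of z 0 "\<theta> z"] \<theta>[of z] r \<kappa> \<tau> by (simp add: mult_le_0_iff)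
  ultimately show thesis
    using that[OF r(1) \<tau>(1) \<kappa>] mono \<theta> by (auto simp: v_def)
qed

text \<open>Successive crossings of the section are at least \<open>\<tau>\<close> apart in time.\<close>

lemma finite_section_points:
  assumes "\<tau> > 0" "\<kappa> > 0"
    and mono: "\<And>w t. w \<in> S \<Longrightarrow> 0 \<le> t \<Longrightarrow> t \<le> \<tau> \<Longrightarrow> \<kappa> * t \<le> (\<phi> t w - w) \<bullet> v"
  shows "finite {y \<in> S. (y - z) \<bullet> v = 0 \<and> (\<exists>t. y = \<phi> t x)}"
proof -
  obtain T where T: "T > 0" "\<phi> T x = x" using periodic by blast
  define D where "D = {t \<in> {0..T}. \<phi> t x \<in> S \<and> (\<phi> t x - z) \<bullet> v = 0}"
  have apart: "t > s + \<tau>" if "s \<in> D" "t \<in> D" "s < t" for s t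
  proof (rule ccontr)
    assume "\<not> ?thesis"
    then have "\<kappa> * (t - s) \<le> (\<phi> (t - s) (\<phi> s x) - \<phi> s x) \<bullet> v"
      using that by (intro mono) (auto simp: D_def)
    also have "\<dots> = 0"
      using that by (simp add: D_def inner_diff_left flip: flow_add)
    finally show False using assms(2) \<open>s < t\<close> by (simp add: mult_le_0_iff)
  qed
  have "finite ((\<lambda>t. \<lfloor>t / \<tau>\<rfloor>) ` D)"
  proof (rule finite_subset)
    show "(\<lambda>t. \<lfloor>t / \<tau>\<rfloor>) ` D \<subseteq> {0..\<lfloor>T / \<tau>\<rfloor>}"
      using assms(1) by (auto simp: D_def intro!: floor_mono divide_right_mono)
  qed simp
  moreover have "inj_on (\<lambda>t. \<lfloor>t / \<tau>\<rfloor>) D"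
  proof (rule linorder_inj_onI)
    fix s t assume st: "s < t" "s \<in> D" "t \<in> D"
    have "(s + \<tau>) / \<tau> \<le> t / \<tau>"
      using apart[OF st(2,3,1)] assms(1) by (intro divide_right_mono) auto
    then have "s / \<tau> + 1 \<le> t / \<tau>"
      using assms(1) by (simp add: add_divide_distrib)
    then show "\<lfloor>s / \<tau>\<rfloor> \<noteq> \<lfloor>t / \<tau>\<rfloor>" by linarith
  qed auto
  ultimately have "finite D" by (rule finite_imageD)
  moreover have "{y \<in> S. (y - z) \<bullet> v = 0 \<and> (\<exists>t. y = \<phi> t x)} \<subseteq> (\<lambda>t. \<phi> t x) ` D"
  proof clarify
    fix t assume t: "\<phi> t x \<in> S" "(\<phi> t x - z) \<bullet> v = 0"
    obtain s where "s \<in> {0..T}" "\<phi> t x = \<phi> s x"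
      using period_reduction[OF T] by blast
    then show "\<phi> t x \<in> (\<lambda>t. \<phi> t x) ` D" using t by (auto simp: D_def)
  qed
  ultimately show ?thesis by (meson finite_imageI finite_subset)
qed

end

text \<open>\<open>E\<close> will be the relation of lying on the same orbit. Iterates of a moved
  point under an increasing map would give infinitely many points of one class. Iterates might leave
  the interval, so the finite part \<open>A\<close> of the class below \<open>s\<close> is counted
  instead: if Q s < s, then \<open>Q\<close> maps \<open>A\<close> injectively into \<open>A\<close>
  without \<open>s\<close>; if Q s > s, every point of \<open>A\<close> has a preimage in
  \<open>A\<close> without \<open>s\<close>.\<close>

lemma strict_mono_finite_classes_fixed:
  fixes Q :: "real \<Rightarrow> real"
  assumes cont: "continuous_on {0..c} Q" and mono: "strict_mono_on {0..c} Q" and Q0: "Q 0 = 0"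
    and E: "\<And>s. s \<in> {0..c} \<Longrightarrow> E s (Q s)" and "symp E" "transp E"
    and fin: "\<And>s. finite {s' \<in> {0..c}. E s s'}"
    and s: "s \<in> {0..c}"
  shows "Q s = s"
proof (cases "s = 0")
  case False
  then have s0: "s > 0" using s by auto
  have less: "Q a < Q b" if "0 \<le> a" "a < b" "b \<le> s" for a b
    using that s by (intro strict_mono_onD[OF mono]) auto
  define A where "A = {s' \<in> {0<..s}. E s s'}"
  have "finite A"
    using s by (intro finite_subset[OF _ fin[of s]]) (auto simp: A_def)
  have "E s s" using E[OF s] \<open>symp E\<close> \<open>transp E\<close> by (meson sympD transpD)
  then have sA: "s \<in> A" using s0 by (simp add: A_def)
  have inj: "inj_on Q A"
  proof (rule linorder_inj_onI)
    fix a b assume "a < b" "a \<in> A" "b \<in> A"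
    then show "Q a \<noteq> Q b" using less[of a b] by (simp add: A_def)
  qed auto
  show ?thesis
  proof (rule ccontr)
    assume "Q s \<noteq> s"
    then consider "Q s < s" | "Q s > s" by linarith
    then show False
    proof cases
      case 1
      have le: "Q a \<le> Q s" if "a \<in> A" for a
        using that less[of a s] by (cases "a = s") (auto simp: A_def)
      have "Q ` A \<subseteq> A"
      proof clarify
        fix a assume a: "a \<in> A"
        have "E s (Q a)" using a E[of a] s \<open>transp E\<close> by (auto simp: A_def dest: transpD)
        then show "Q a \<in> A"
          using le[OF a] less[of 0 a] a 1 Q0 by (auto simp: A_def)
      qed
      then have "Q ` A = A" using \<open>finite A\<close> inj endo_inj_surj by blast
      then show False using sA le 1 by (metis imageE not_less)
    next
      case 2
      have "A \<subseteq> Q ` (A - {s})"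
      proof
        fix a assume a: "a \<in> A"
        have "\<exists>b\<ge>0. b \<le> s \<and> Q b = a"
          using a 2 Q0 s cont
          by (intro IVT') (auto simp: A_def intro: continuous_on_subset)
        then obtain b where b: "0 \<le> b" "b \<le> s" "Q b = a" by blast
        have "b \<noteq> 0" "b \<noteq> s" using b a Q0 2 by (auto simp: A_def)
        moreover have "E s b"
          using a b E[of b] s \<open>symp E\<close> \<open>transp E\<close> by (auto simp: A_def) (meson sympD transpD)
        ultimately show "a \<in> Q ` (A - {s})" using b by (auto simp: A_def)
      qed
      then have "card A \<le> card (Q ` (A - {s}))"
        using \<open>finite A\<close> by (intro card_mono) auto
      also have "\<dots> \<le> card (A - {s})" using \<open>finite A\<close> by (intro card_image_le) auto
      also have "\<dots> < card A" using \<open>finite A\<close> sA by (rule card_Diff1_less)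
      finally show False by simp
    qed
  qed
qed (use Q0 in simp)

lemma strict_mono_finite_classes_id:
  fixes Q :: "real \<Rightarrow> real"
  assumes cont: "continuous_on {-c..c} Q" and mono: "strict_mono_on {-c..c} Q" and Q0: "Q 0 = 0"
    and E: "\<And>s. s \<in> {-c..c} \<Longrightarrow> E s (Q s)" and E': "symp E" "transp E"
    and fin: "\<And>s. finite {s' \<in> {-c..c}. E s s'}"
    and s: "s \<in> {-c..c}"
  shows "Q s = s"
proof (cases "s \<ge> 0")
  case True
  show ?thesis
  proof (rule strict_mono_finite_classes_fixed[where E = E and c = c])
    show "finite {s' \<in> {0..c}. E s s'}" for s
      by (rule finite_subset[OF _ fin[of s]]) auto
  qed (use True s assms in \<open>auto intro: continuous_on_subset monotone_on_subset\<close>)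
next
  case False
  have "- Q (- (- s)) = - s"
  proof (rule strict_mono_finite_classes_fixed[where E = "\<lambda>a b. E (- a) (- b)" and c = c])
    show "continuous_on {0..c} (\<lambda>x. - Q (- x))"
      by (intro continuous_intros continuous_on_compose2[OF cont]) auto
    show "strict_mono_on {0..c} (\<lambda>x. - Q (- x))"
      by (rule strict_mono_onI) (use strict_mono_onD[OF mono] in auto)
    show "finite {s' \<in> {0..c}. E (- s) (- s')}" for s
    proof (rule finite_subset)
      show "{s' \<in> {0..c}. E (- s) (- s')} \<subseteq> uminus ` {s' \<in> {-c..c}. E (- s) s'}"
        by (force simp: image_iff intro: exI[of _ "- _"])
    qed (use fin in simp)
    show "symp (\<lambda>a b. E (- a) (- b))" "transp (\<lambda>a b. E (- a) (- b))"
      using E' unfolding symp_def transp_def by blast+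
  qed (use False s Q0 E in auto)
  then show ?thesis by simp
qed

text \<open>The points near \<open>z\<close> return to a section through \<open>z\<close> after a time close to the period of
  \<open>z\<close>. The square of the return map is increasing, hence the identity because every orbit meets
  the section in finitely many points; the return map itself need not be shown to preserve
  orientation.\<close>

lemma planar_nearby_periods:
  fixes F :: "real ^ 2 \<Rightarrow> real ^ 2"
  assumes flow: "compact_orbit_flow F \<phi>" and Fz: "F z \<noteq> 0"
  shows "\<exists>T>0. \<forall>e>0. \<exists>d>0. \<forall>w\<in>ball z d. \<exists>S. \<bar>S - T\<bar> < e \<and> \<phi> S w = w"
proof -
  interpret compact_orbit_flow F \<phi> by (rule flow)
  obtain T where T: "T > 0" "\<phi> T z = z" using periodic by blast
  define v where "v = F z"
  obtain r \<tau> \<kappa> \<theta> B where r: "r > 0" and \<tau>: "\<tau> > 0" and \<kappa>: "\<kappa> > 0"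
    and mono: "\<And>w s t. w \<in> ball z r \<Longrightarrow> - \<tau> \<le> s \<Longrightarrow> s \<le> t \<Longrightarrow> t \<le> \<tau> \<Longrightarrow>
      \<kappa> * (t - s) \<le> (\<phi> t w - \<phi> s w) \<bullet> v"
    and \<theta>: "\<And>w. w \<in> ball z r \<Longrightarrow> \<bar>\<theta> w\<bar> \<le> \<tau> \<and> (\<phi> (\<theta> w) w - z) \<bullet> v = 0"
    and \<theta>_lip: "B-lipschitz_on (ball z r) \<theta>" and \<theta>z: "\<theta> z = 0"
    by (rule flow_box[OF Fz]) (rule that[unfolded v_def])
  have \<theta>_cont: "continuous_on (ball z r) \<theta>" using \<theta>_lip by (rule lipschitz_on_continuous_on)
  \<comment> \<open>\<open>n\<close> is \<open>v\<close> turned by a right angle. Only in the plane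
    is the section a line, with parametrisation \<open>\<gamma>\<close> and coordinate
    \<open>m\<close>; the return map then acts on an interval, where continuity and injectivity
    force monotonicity.\<close>
  define n :: "real ^ 2" where "n = vector [- v $ 2, v $ 1]"
  have nn: "n \<bullet> n = v \<bullet> v"
    by (simp add: n_def inner_vec_def sum_2)
  then have n_pos: "n \<bullet> n > 0" using Fz by (simp add: v_def)
  define \<gamma> where "\<gamma> s = z + s *\<^sub>R n" for s
  define m where "m y = ((y - z) \<bullet> n) / (n \<bullet> n)" for y
  have nv: "n \<bullet> v = 0" by (simp add: n_def inner_vec_def sum_2)
  have m_\<gamma> [simp]: "m (\<gamma> s) = s" for s using n_pos by (simp add: m_def \<gamma>_def)
  have \<gamma>0 [simp]: "\<gamma> 0 = z" by (simp add: \<gamma>_def)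
  have \<gamma>_section: "(\<gamma> s - z) \<bullet> v = 0" for s by (simp add: \<gamma>_def nv)
  have \<gamma>_m: "\<gamma> (m y) = y" if "(y - z) \<bullet> v = 0" for y
  proof -
    have "(v \<bullet> v) *\<^sub>R (y - z) = ((y - z) \<bullet> v) *\<^sub>R v + ((y - z) \<bullet> n) *\<^sub>R n"
      by (simp add: vec_eq_iff forall_2 inner_vec_def sum_2 n_def algebra_simps)
    then have "(n \<bullet> n) *\<^sub>R (y - z) = ((y - z) \<bullet> n) *\<^sub>R n" using that nn by simp
    then have "m y *\<^sub>R n = (1 / (n \<bullet> n)) *\<^sub>R ((n \<bullet> n) *\<^sub>R (y - z))"
      by (simp add: m_def)
    also have "\<dots> = y - z" using n_pos by simp
    finally show ?thesis by (simp add: \<gamma>_def)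
  qed
  have unique: "t = 0"
    if "w \<in> ball z r" "(w - z) \<bullet> v = 0" "\<bar>t\<bar> \<le> \<tau>" "(\<phi> t w - z) \<bullet> v = 0" for w t
    using mono[of w 0 t] mono[of w t 0] that \<tau> \<kappa>
    by (cases "t \<ge> 0") (auto simp: inner_diff_left mult_le_0_iff zero_le_mult_iff abs_le_iff)
  \<comment> \<open>After time \<open>T\<close> the point is near \<open>z\<close> again but off the
    section; \<open>\<eta>\<close> is the small correction of the return time and \<open>P\<close>
    the return map in the coordinate of the section.\<close>
  define \<eta> where "\<eta> s = \<theta> (\<phi> T (\<gamma> s))" for s
  define P where "P s = m (\<phi> (\<eta> s) (\<phi> T (\<gamma> s)))" for s
  have \<gamma>_cont: "continuous_on A \<gamma>" for A unfolding \<gamma>_def by (intro continuous_intros)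
  have T\<gamma>_cont: "continuous_on A (\<lambda>s. \<phi> T (\<gamma> s))" for A
    by (rule continuous_on_compose2[OF flow_continuous_space[of UNIV] \<gamma>_cont]) auto
  have near0: "\<exists>c>0. \<forall>s\<in>{-c..c}. dist (f s) (f 0) < e"
    if "continuous_on {-b..b} f" "b > 0" "e > 0" for f :: "real \<Rightarrow> 'x::metric_space" and b e
  proof -
    have "isCont f 0" by (rule continuous_on_interior[OF that(1)]) (use that in auto)
    then obtain d where d: "d > 0" "\<And>s. dist s 0 < d \<Longrightarrow> dist (f s) (f 0) < e"
      using \<open>e > 0\<close> unfolding continuous_at_eps_delta by blast
    show ?thesis by (rule exI[of _ "d / 2"]) (use d in auto)
  qed
  obtain c0 where c0: "c0 > 0" "\<And>s. s \<in> {-c0..c0} \<Longrightarrow> \<gamma> s \<in> ball z r \<and> \<phi> T (\<gamma> s) \<in> ball z r"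
  proof -
    obtain c where "c > 0" "\<And>s. s \<in> {-c..c} \<Longrightarrow> dist (\<gamma> s) (\<gamma> 0) < r"
      using near0[of 1 \<gamma> r] \<gamma>_cont r by auto
    moreover obtain c' where "c' > 0" "\<And>s. s \<in> {-c'..c'} \<Longrightarrow> dist (\<phi> T (\<gamma> s)) (\<phi> T (\<gamma> 0)) < r"
      using near0[of 1 "\<lambda>s. \<phi> T (\<gamma> s)" r] T\<gamma>_cont r by auto
    ultimately show thesis using that[of "min c c'"] T(2) by (auto simp: dist_commute minus_min_eq_max)
  qed
  have \<eta>_cont: "continuous_on {-c0..c0} \<eta>" unfolding \<eta>_def
    by (rule continuous_on_compose2[OF \<theta>_cont T\<gamma>_cont]) (use c0 in auto)
  have flow_joint: "continuous_on A (\<lambda>a. \<phi> (h a) (y a))"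
    if "continuous_on A h" "continuous_on A y" for h y and A :: "'x::metric_space set"
    by (rule flow_continuous[OF that])
  have P_cont: "continuous_on {-c0..c0} P" unfolding P_def m_def
    using n_pos by (intro continuous_intros flow_joint \<eta>_cont T\<gamma>_cont) auto
  have \<eta>0: "\<eta> 0 = 0" by (simp add: \<eta>_def T \<theta>z)
  have P0: "P 0 = 0" using m_\<gamma>[of 0] by (simp add: P_def \<eta>0 T)
  have return: "\<phi> (\<eta> s + T) (\<gamma> s) = \<gamma> (P s)" if "s \<in> {-c0..c0}" for s
  proof -
    have "(\<phi> (\<eta> s) (\<phi> T (\<gamma> s)) - z) \<bullet> v = 0"
      using \<theta>[of "\<phi> T (\<gamma> s)"] c0(2)[OF that] by (auto simp: \<eta>_def)
    from \<gamma>_m[OF this] show ?thesis by (simp add: P_def flow_add)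
  qed
  \<comment> \<open>Half of \<open>\<tau>\<close>, because injectivity of \<open>P\<close> compares
    two corrections, whose difference must stay in the window where \<open>unique\<close> excludes a
    second crossing.\<close>
  obtain c1 where c1: "c1 > 0" "c1 \<le> c0" "\<And>s. s \<in> {-c1..c1} \<Longrightarrow> \<bar>\<eta> s\<bar> < \<tau> / 2"
  proof -
    obtain c where "c > 0" "\<And>s. s \<in> {-c..c} \<Longrightarrow> dist (\<eta> s) (\<eta> 0) < \<tau> / 2"
      using near0[OF \<eta>_cont c0(1), of "\<tau> / 2"] \<tau> by auto
    then show thesis using that[of "min c c0"] c0(1) by (auto simp: \<eta>0 minus_min_eq_max)
  qed
  have "inj_on P {-c1..c1}"
  proof (rule inj_onI)
    fix s s' assume s: "s \<in> {-c1..c1}" "s' \<in> {-c1..c1}" and eq: "P s = P s'"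
    have "\<phi> (\<eta> s + T) (\<gamma> s) = \<phi> (\<eta> s' + T) (\<gamma> s')"
      using return[of s] return[of s'] s c1(2) eq by auto
    then have "\<phi> (- (\<eta> s + T)) (\<phi> (\<eta> s + T) (\<gamma> s)) = \<phi> (- (\<eta> s + T)) (\<phi> (\<eta> s' + T) (\<gamma> s'))"
      by (rule arg_cong)
    then have g: "\<gamma> s = \<phi> (\<eta> s' - \<eta> s) (\<gamma> s')" by (simp flip: flow_add)
    have "\<eta> s' - \<eta> s = 0"
    proof (rule unique[of "\<gamma> s'"])
      show "\<bar>\<eta> s' - \<eta> s\<bar> \<le> \<tau>" using c1(3)[OF s(1)] c1(3)[OF s(2)] by linarith
    qed (use c0(2)[of s'] s c1(2) \<gamma>_section[of s] \<gamma>_section[of s'] g in auto)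
    then show "s = s'" using g by (metis flow_0 m_\<gamma>)
  qed
  then have P_mono: "strict_mono_on {-c1..c1} P \<or> strict_antimono_on {-c1..c1} P"
    using injective_eq_monotone_map[of "{-c1..c1}" P] continuous_on_subset[OF P_cont] c1
    by (auto simp: is_interval_cc)
  obtain c2 where c2: "c2 > 0" "c2 \<le> c1" "\<And>s. s \<in> {-c2..c2} \<Longrightarrow> P s \<in> {-c1..c1}"
  proof -
    obtain c where "c > 0" "\<And>s. s \<in> {-c..c} \<Longrightarrow> dist (P s) (P 0) < c1"
      using near0[OF P_cont c0(1), of c1] c1(1) by auto
    then show thesis using that[of "min c c1"] c1(1)
      by (force simp: P0 minus_min_eq_max)
  qed
  have Q_id: "P (P s) = s" if "s \<in> {-c2..c2}" for s
  proof (rule strict_mono_finite_classes_id[where E = "\<lambda>a b. \<exists>t. \<gamma> b = \<phi> t (\<gamma> a)", OF _ _ _ _ _ _ _ that])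
    show "continuous_on {-c2..c2} (\<lambda>s. P (P s))"
      by (rule continuous_on_compose2[OF P_cont continuous_on_subset[OF P_cont]])
         (use c1 c2 in force)+
    show "strict_mono_on {-c2..c2} (\<lambda>s. P (P s))"
    proof (rule strict_mono_onI)
      fix a b assume ab: "a \<in> {-c2..c2}" "b \<in> {-c2..c2}" "a < b"
      then have ab': "a \<in> {-c1..c1}" "b \<in> {-c1..c1}" using c2 by auto
      from P_mono show "P (P a) < P (P b)"
      proof
        assume "strict_mono_on {-c1..c1} P"
        then show ?thesis using ab ab' c2(3) by (meson strict_mono_onD)
      next
        assume "strict_antimono_on {-c1..c1} P"
        then show ?thesis using ab ab' c2(3) by (meson monotone_onD)
      qed
    qed
    show "\<exists>t. \<gamma> (P (P s)) = \<phi> t (\<gamma> s)" if s: "s \<in> {-c2..c2}" for s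
    proof -
      have "\<gamma> (P (P s)) = \<phi> (\<eta> (P s) + T) (\<phi> (\<eta> s + T) (\<gamma> s))"
        using return[of s] return[of "P s"] c2(3)[OF s] s c1 c2 by auto
      then show ?thesis by (metis flow_add)
    qed
    show "symp (\<lambda>a b. \<exists>t. \<gamma> b = \<phi> t (\<gamma> a))"
      by (rule sympI) (metis flow_minus(1))
    show "transp (\<lambda>a b. \<exists>t. \<gamma> b = \<phi> t (\<gamma> a))"
      by (rule transpI) (metis flow_add)
    show "finite {s' \<in> {-c2..c2}. \<exists>t. \<gamma> s' = \<phi> t (\<gamma> s)}" for s
    proof (rule finite_imageD)
      have "finite {y \<in> ball z r. (y - z) \<bullet> v = 0 \<and> (\<exists>t. y = \<phi> t (\<gamma> s))}"
        using mono[of _ 0] \<tau> \<kappa> by (intro finite_section_points[of \<tau> \<kappa>]) auto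
      then show "finite (\<gamma> ` {s' \<in> {-c2..c2}. \<exists>t. \<gamma> s' = \<phi> t (\<gamma> s)})"
      proof (rule finite_subset[rotated])
        have "\<gamma> a \<in> ball z r" if "a \<in> {-c2..c2}" for a
          using c0(2)[of a] that c1(2) c2(2) by auto
        then show "\<gamma> ` {s' \<in> {-c2..c2}. \<exists>t. \<gamma> s' = \<phi> t (\<gamma> s)} \<subseteq>
            {y \<in> ball z r. (y - z) \<bullet> v = 0 \<and> (\<exists>t. y = \<phi> t (\<gamma> s))}"
          using \<gamma>_section by blast
      qed
      show "inj_on \<gamma> {s' \<in> {-c2..c2}. \<exists>t. \<gamma> s' = \<phi> t (\<gamma> s)}"
        by (metis (no_types, lifting) inj_onI m_\<gamma>)
    qed
  qed (simp add: P0)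
  \<comment> \<open>The total correction of the return time over two rounds; it vanishes at 0, so
    the periods tend to \<open>2 * T\<close>.\<close>
  define h where "h s = \<eta> s + \<eta> (P s)" for s
  have period: "\<phi> (h s + 2 * T) (\<gamma> s) = \<gamma> s" if s: "s \<in> {-c2..c2}" for s
  proof -
    have "\<phi> (\<eta> (P s) + T) (\<phi> (\<eta> s + T) (\<gamma> s)) = \<gamma> (P (P s))"
      using return[of s] return[of "P s"] c2(3)[OF s] s c1 c2 by auto
    then show ?thesis
      using Q_id[OF s] by (simp add: h_def algebra_simps flip: flow_add)
  qed
  have h_cont: "continuous_on {-c2..c2} h" unfolding h_def
    by (intro continuous_intros continuous_on_subset[OF \<eta>_cont]
          continuous_on_compose2[OF \<eta>_cont continuous_on_subset[OF P_cont]])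
       (use c1 c2 in force)+
  define \<sigma> where "\<sigma> w = m (\<phi> (\<theta> w) w)" for w
  have \<sigma>_cont: "continuous_on (ball z r) \<sigma>" unfolding \<sigma>_def m_def
    using n_pos by (intro continuous_intros flow_joint \<theta>_cont) auto
  have \<sigma>z: "\<sigma> z = 0" using m_\<gamma>[of 0] by (simp add: \<sigma>_def \<theta>z)
  have \<sigma>_isCont: "isCont \<sigma> z"
    using \<sigma>_cont r by (simp add: continuous_on_eq_continuous_at)
  have "\<exists>d>0. \<forall>w\<in>ball z d. \<exists>S. \<bar>S - 2 * T\<bar> < e \<and> \<phi> S w = w" if "e > 0" for e
  proof -
    obtain c where c: "c > 0" "c \<le> c2" "\<And>s. s \<in> {-c..c} \<Longrightarrow> \<bar>h s\<bar> < e"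
    proof -
      obtain c where "c > 0" "\<And>s. s \<in> {-c..c} \<Longrightarrow> dist (h s) (h 0) < e"
        using near0[OF h_cont c2(1) \<open>e > 0\<close>] by auto
      then show thesis using that[of "min c c2"] c2(1) by (auto simp: h_def \<eta>0 P0 minus_min_eq_max)
    qed
    obtain d where d: "d > 0" "\<And>w. dist w z < d \<Longrightarrow> dist (\<sigma> w) (\<sigma> z) < c"
      using \<sigma>_isCont c(1) unfolding continuous_at_eps_delta by blast
    show ?thesis
    proof (rule exI[of _ "min d r"], intro conjI ballI)
      fix w assume w: "w \<in> ball z (min d r)"
      then have \<sigma>w: "\<sigma> w \<in> {-c..c}"
        using d(2)[of w] by (auto simp: dist_commute \<sigma>z abs_less_iff)
      have eq: "\<phi> (\<theta> w) w = \<gamma> (\<sigma> w)"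
        unfolding \<sigma>_def using w \<theta>[of w] by (simp add: \<gamma>_m)
      \<comment> \<open>A period is shared by all points of an orbit, so that of the section point
        is carried back to \<open>w\<close>.\<close>
      have "\<phi> (h (\<sigma> w) + 2 * T) (\<phi> (\<theta> w) w) = \<phi> (\<theta> w) w"
        unfolding eq using period[of "\<sigma> w"] \<sigma>w c(2) by auto
      then have "\<phi> (\<theta> w) (\<phi> (h (\<sigma> w) + 2 * T) w) = \<phi> (\<theta> w) w"
        by (metis add.commute flow_add)
      then have "\<phi> (h (\<sigma> w) + 2 * T) w = w" by (metis flow_minus(1))
      then show "\<exists>S. \<bar>S - 2 * T\<bar> < e \<and> \<phi> S w = w"
        using c(3)[OF \<sigma>w] by (intro exI[of _ "h (\<sigma> w) + 2 * T"]) auto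
    qed (use d r in auto)
  qed
  then show ?thesis using T(1) by (intro exI[of _ "2 * T"]) auto
qed

subsection \<open>Linear growth of the flow\<close>

context compact_orbit_flow
begin

text \<open>The Lipschitz bound comes for free: \<open>\<phi> (T w) w'\<close> is close to \<open>w\<close>, and it differs from
  \<open>w'\<close> by the time \<open>T w - T w'\<close>, at positive speed across a section.\<close>

lemma lipschitz_period:
  assumes Fz: "F z \<noteq> 0" and "T0 > 0"
    and per: "\<And>e. e > 0 \<Longrightarrow> \<exists>d>0. \<forall>w\<in>ball z d. \<exists>S. \<bar>S - T0\<bar> < e \<and> \<phi> S w = w"
  obtains d a b L T where "d > 0" "a > 0" "L-lipschitz_on (ball z d) T"
    and "\<And>w. w \<in> ball z d \<Longrightarrow> a \<le> T w \<and> T w \<le> b \<and> \<phi> (T w) w = w"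
proof -
  define v where "v = F z"
  obtain r \<tau> \<kappa> \<theta> B where r: "r > 0" and \<tau>: "\<tau> > 0" and \<kappa>: "\<kappa> > 0"
    and mono: "\<And>w s t. w \<in> ball z r \<Longrightarrow> - \<tau> \<le> s \<Longrightarrow> s \<le> t \<Longrightarrow> t \<le> \<tau> \<Longrightarrow>
      \<kappa> * (t - s) \<le> (\<phi> t w - \<phi> s w) \<bullet> v"
    and \<theta>: "\<And>w. w \<in> ball z r \<Longrightarrow> \<bar>\<theta> w\<bar> \<le> \<tau> \<and> (\<phi> (\<theta> w) w - z) \<bullet> v = 0"
    and "B-lipschitz_on (ball z r) \<theta>" and "\<theta> z = 0"
    by (rule flow_box[OF Fz]) (rule that[unfolded v_def])
  \<comment> \<open>\<tau> / 2 makes any two of the chosen periods differ by at most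
    \<open>\<tau>\<close>, the range of the speed estimate; T0 / 2 keeps them away from 0. The
    periods may otherwise be chosen arbitrarily: closeness to \<open>T0\<close> alone forces the
    Lipschitz bound.\<close>
  define e where "e = min (\<tau> / 2) (T0 / 2)"
  have e: "e > 0" "e \<le> \<tau> / 2" "e \<le> T0 / 2" using \<tau> \<open>T0 > 0\<close> by (auto simp: e_def)
  obtain d1 where d1: "d1 > 0" "\<forall>w\<in>ball z d1. \<exists>S. \<bar>S - T0\<bar> < e \<and> \<phi> S w = w"
    using per[OF e(1)] by blast
  then obtain T where T: "\<And>w. w \<in> ball z d1 \<Longrightarrow> \<bar>T w - T0\<bar> < e \<and> \<phi> (T w) w = w"
    by metis
  obtain d2 C where d2: "d2 > 0" "C \<ge> 1" and
    C: "\<And>w w' t. w \<in> ball z d2 \<Longrightarrow> w' \<in> ball z d2 \<Longrightarrow> \<bar>t\<bar> \<le> 2 * T0 \<Longrightarrow>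
      dist (\<phi> t w) (\<phi> t w') \<le> C * dist w w'"
    using flow_lipschitz_near_orbit[of z "2 * T0"] by (metis flow_0)
  define d where "d = min r (min d1 d2)"
  have bounds: "T0 / 2 \<le> T w \<and> T w \<le> 2 * T0" if "w \<in> ball z d" for w
    using T[of w] that e by (auto simp: d_def abs_less_iff)
  have "((norm v * (C + 1)) / \<kappa>)-lipschitz_on (ball z d) T"
  proof (rule lipschitz_onI)
    fix w w' assume w: "w \<in> ball z d" "w' \<in> ball z d"
    define s where "s = T w - T w'"
    have T': "\<phi> (T w) w = w" "\<phi> (T w') w' = w'" "\<bar>s\<bar> \<le> \<tau>"
      using T[of w] T[of w'] w e unfolding s_def d_def by (auto simp: abs_less_iff)
    have "\<phi> s w' = \<phi> s (\<phi> (T w') w')" using T' by simp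
    also have "\<dots> = \<phi> (T w) w'" by (simp add: s_def flip: flow_add)
    finally have s: "\<phi> s w' = \<phi> (T w) w'" .
    have "\<kappa> * \<bar>s\<bar> \<le> \<bar>(\<phi> s w' - w') \<bullet> v\<bar>"
      using mono[of w' 0 s] mono[of w' s 0] w T'(3) \<tau>
      by (cases "s \<ge> 0") (auto simp: d_def inner_diff_left)
    also have "\<dots> \<le> norm (\<phi> s w' - w') * norm v" by (rule Cauchy_Schwarz_ineq2)
    also have "\<dots> \<le> ((C + 1) * dist w w') * norm v"
    proof (intro mult_right_mono)
      have "dist (\<phi> (T w) w') (\<phi> (T w) w) \<le> C * dist w' w"
        using bounds[OF w(1)] w \<open>T0 > 0\<close> by (intro C) (auto simp: d_def)
      then show "norm (\<phi> s w' - w') \<le> (C + 1) * dist w w'"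
        using dist_triangle[of "\<phi> s w'" w' w] T' s
        by (simp add: dist_commute algebra_simps flip: dist_norm)
    qed simp
    finally show "dist (T w) (T w') \<le> norm v * (C + 1) / \<kappa> * dist w w'"
      using \<kappa> by (simp add: s_def dist_real_def field_simps)
  qed (use \<kappa> d2 in auto)
  moreover have "d > 0" using r d1 d2 by (auto simp: d_def)
  moreover have "T0 / 2 \<le> T w \<and> T w \<le> 2 * T0 \<and> \<phi> (T w) w = w" if "w \<in> ball z d" for w
    using bounds[OF that] T[of w] that by (auto simp: d_def)
  ultimately show thesis using that[of d "T0 / 2" _ T "2 * T0"] \<open>T0 > 0\<close> by auto
qed

lemma flow_speed:
  assumes "\<And>s. norm (F (\<phi> s y)) \<le> M"
  shows "dist (\<phi> t y) y \<le> M * \<bar>t\<bar>"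
proof -
  have "norm (\<phi> t y - \<phi> 0 y) \<le> M * norm (t - 0)"
  proof (rule differentiable_bound[of UNIV])
    show "((\<lambda>t. \<phi> t y) has_derivative (\<lambda>h. h *\<^sub>R F (\<phi> s y))) (at s within UNIV)" for s
      using flow_deriv[of y s] by (simp add: has_vector_derivative_def)
    show "onorm (\<lambda>h. h *\<^sub>R F (\<phi> s y)) \<le> M" for s
      using mult_right_mono[OF assms[of s] abs_ge_zero]
      by (intro onorm_le) (simp add: mult.commute)
  qed auto
  then show ?thesis by (simp add: dist_norm)
qed

text \<open>Over \<open>n\<close> periods two nearby orbits get out of step by \<open>n\<close> times the difference of their
  periods only.\<close>

lemma flow_linear_growth:
  assumes Fz: "F z \<noteq> 0" and "T0 > 0"
    and per: "\<And>e. e > 0 \<Longrightarrow> \<exists>d>0. \<forall>w\<in>ball z d. \<exists>S. \<bar>S - T0\<bar> < e \<and> \<phi> S w = w"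
  obtains d C b R where "d > 0" "C \<ge> 1" "b \<ge> 0"
    and "\<And>u u' t. u \<in> ball z d \<Longrightarrow> u' \<in> ball z d \<Longrightarrow>
      dist (\<phi> t u) (\<phi> t u') \<le> C * (1 + \<bar>t\<bar>) * dist u u'"
    and "\<And>u t. u \<in> ball z d \<Longrightarrow> \<exists>r\<in>{0..b}. \<phi> t u = \<phi> r u"
    and "\<And>u t. u \<in> ball z d \<Longrightarrow> norm (\<phi> t u) \<le> R"
proof -
  obtain d1 a b K T where d1: "d1 > 0" "a > 0" and K: "K-lipschitz_on (ball z d1) T"
    and T: "\<And>w. w \<in> ball z d1 \<Longrightarrow> a \<le> T w \<and> T w \<le> b \<and> \<phi> (T w) w = w"
    by (rule lipschitz_period[OF assms]) (assumption, rule that)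
  obtain d2 C R where d2: "d2 > 0" "C \<ge> 1" and
    C: "\<And>w w' t. w \<in> ball z d2 \<Longrightarrow> w' \<in> ball z d2 \<Longrightarrow> \<bar>t\<bar> \<le> b \<Longrightarrow>
      norm (\<phi> t w) \<le> R \<and> dist (\<phi> t w) (\<phi> t w') \<le> C * dist w w'"
    using flow_lipschitz_near_orbit[of z b] by (metis flow_0)
  define d where "d = min d1 d2"
  have d: "d > 0" using d1 d2 by (simp add: d_def)
  have b: "b \<ge> 0" using T[of z] d1 by auto
  have reduce: "\<exists>n::int. \<exists>r\<in>{0..b}. t = of_int n * T u + r \<and> \<phi> t u = \<phi> r u" if u: "u \<in> ball z d" for u t
  proof -
    have Tu: "a \<le> T u" "T u \<le> b" "\<phi> (T u) u = u" using T[of u] u by (auto simp: d_def)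
    obtain n :: int and r where "r \<in> {0..T u}" "t = of_int n * T u + r" "\<phi> t u = \<phi> r u"
      using period_reduction[OF less_le_trans[OF d1(2) Tu(1)] Tu(3)] by metis
    then show ?thesis using Tu by (intro exI[of _ n] bexI[of _ r]) auto
  qed
  have R: "norm (\<phi> t u) \<le> R" if u: "u \<in> ball z d" for u t
    using reduce[OF u, of t] C[of u u] u by (auto simp: d_def)
  have "compact (F ` cball 0 R)"
    by (intro compact_continuous_image continuous_on_subset[OF F_continuous]) auto
  then obtain M where M: "M > 0" "\<And>y. y \<in> cball 0 R \<Longrightarrow> norm (F y) \<le> M"
    by (metis bounded_pos compact_imp_bounded imageI)
  have K0: "K \<ge> 0" using K by (rule lipschitz_on_nonneg)
  \<comment> \<open>\<open>C\<close> accounts for the remainder of less than a full period. The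
    other term is the speed \<open>M\<close> times the phase shift: about (|t| + b) / a periods,
    each off by at most \<open>K * dist u u'\<close>.\<close>
  define C' where "C' = C + M * K * (1 + b) / a"
  have C': "C' \<ge> 1" using d2 M K0 b d1 by (simp add: C'_def add_increasing2)
  have growth: "dist (\<phi> t u) (\<phi> t u') \<le> C' * (1 + \<bar>t\<bar>) * dist u u'"
    if u: "u \<in> ball z d" "u' \<in> ball z d" for u u' t
  proof -
    obtain n :: int and r where r: "r \<in> {0..b}" "t = of_int n * T u + r" "\<phi> t u = \<phi> r u"
      using reduce[OF u(1)] by blast
    define e where "e = of_int n * (T u - T u')"
    have Tu: "a \<le> T u" "\<phi> (T u') u' = u'" using T u by (auto simp: d_def)
    have "\<phi> t u' = \<phi> (e + r + of_int n * T u') u'" by (simp add: r e_def algebra_simps)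
    also have "\<dots> = \<phi> e (\<phi> r u')"
      by (simp only: flow_add flow_periods[OF Tu(2)])
    finally have u': "\<phi> t u' = \<phi> e (\<phi> r u')" .
    have "\<bar>of_int n\<bar> * a \<le> \<bar>of_int n\<bar> * T u"
      using Tu(1) by (intro mult_left_mono) auto
    also have "\<dots> = \<bar>t - r\<bar>" using r(2) Tu(1) d1(2) by (simp add: abs_mult)
    also have "\<dots> \<le> \<bar>t\<bar> + b" using r(1) by auto
    also have "\<dots> \<le> (1 + b) * (1 + \<bar>t\<bar>)" using b by (simp add: algebra_simps)
    finally have n: "\<bar>of_int n\<bar> \<le> (1 + b) * (1 + \<bar>t\<bar>) / a"
      using d1(2) by (simp add: pos_le_divide_eq)
    have "\<bar>e\<bar> = \<bar>of_int n\<bar> * dist (T u) (T u')" by (simp add: e_def abs_mult dist_real_def)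
    also have "\<dots> \<le> (1 + b) * (1 + \<bar>t\<bar>) / a * (K * dist u u')"
      using n u b d1(2) lipschitz_onD[OF K, of u u'] by (intro mult_mono) (auto simp: d_def)
    finally have e: "\<bar>e\<bar> \<le> (1 + b) * (1 + \<bar>t\<bar>) / a * (K * dist u u')" .
    have "dist (\<phi> e (\<phi> r u')) (\<phi> r u') \<le> M * \<bar>e\<bar>"
      by (rule flow_speed) (use M(2) R[OF u(2)] in \<open>simp flip: flow_add\<close>)
    also have "\<dots> \<le> M * ((1 + b) * (1 + \<bar>t\<bar>) / a * (K * dist u u'))"
      using e M(1) by (intro mult_left_mono) auto
    also have "\<dots> = M * K * (1 + b) / a * (1 + \<bar>t\<bar>) * dist u u'" by simp
    finally have 1: "dist (\<phi> e (\<phi> r u')) (\<phi> r u') \<le> M * K * (1 + b) / a * (1 + \<bar>t\<bar>) * dist u u'" .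
    have "dist (\<phi> r u) (\<phi> r u') \<le> C * dist u u'"
      using C[of u u' r] u r(1) by (auto simp: d_def)
    also have "\<dots> \<le> C * (1 + \<bar>t\<bar>) * dist u u'"
      using d2(2) by (intro mult_right_mono) auto
    finally have 2: "dist (\<phi> r u) (\<phi> r u') \<le> C * (1 + \<bar>t\<bar>) * dist u u'" .
    have "dist (\<phi> t u) (\<phi> t u') \<le> dist (\<phi> r u) (\<phi> r u') + dist (\<phi> e (\<phi> r u')) (\<phi> r u')"
      unfolding r(3) u' by (rule dist_triangle2)
    then show ?thesis
      using 1 2 unfolding C'_def distrib_right by linarith
  qed
  show thesis
    by (rule that[OF d C' b growth _ R]) (use reduce in blast)+
qed

text \<open>A perturbed solution has to be compared with an orbit wherever it is on that orbit, not
  only near \<open>z\<close>. Modulo the period the time \<open>s\<close> is some r in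
  \<open>{0..b}\<close>, so pulling \<open>w\<close> back by r costs the bounded factor
  \<open>C2\<close> and lands near \<open>z\<close>, where linear growth is known. Dividing by
  \<open>2 * C2\<close> in the radius leaves room for the pull-back.\<close>

lemma flow_linear_growth_near_orbits:
  assumes "F z \<noteq> 0" and "T0 > 0"
    and "\<And>e. e > 0 \<Longrightarrow> \<exists>d>0. \<forall>w\<in>ball z d. \<exists>S. \<bar>S - T0\<bar> < e \<and> \<phi> S w = w"
  obtains d C R where "d > 0" "C \<ge> 1"
    and "\<And>u s t w. u \<in> ball z d \<Longrightarrow> w \<in> ball (\<phi> s u) d \<Longrightarrow>
      dist (\<phi> (t + s) u) (\<phi> t w) \<le> C * (1 + \<bar>t\<bar>) * dist (\<phi> s u) w"
    and "\<And>u t. u \<in> ball z d \<Longrightarrow> norm (\<phi> t u) \<le> R"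
proof -
  obtain d1 C1 b R where d1: "d1 > 0" "C1 \<ge> 1" and b: "b \<ge> 0"
    and growth: "\<And>u u' t. u \<in> ball z d1 \<Longrightarrow> u' \<in> ball z d1 \<Longrightarrow>
      dist (\<phi> t u) (\<phi> t u') \<le> C1 * (1 + \<bar>t\<bar>) * dist u u'"
    and reduce: "\<And>u t. u \<in> ball z d1 \<Longrightarrow> \<exists>r\<in>{0..b}. \<phi> t u = \<phi> r u"
    and R: "\<And>u t. u \<in> ball z d1 \<Longrightarrow> norm (\<phi> t u) \<le> R"
    by (rule flow_linear_growth[OF assms]) (assumption, rule that)
  obtain d2 C2 where d2: "d2 > 0" "C2 \<ge> 1" and
    C2: "\<And>s w w' t. w \<in> ball (\<phi> s z) d2 \<Longrightarrow> w' \<in> ball (\<phi> s z) d2 \<Longrightarrow> \<bar>t\<bar> \<le> b \<Longrightarrow>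
      dist (\<phi> t w) (\<phi> t w') \<le> C2 * dist w w'"
    using flow_lipschitz_near_orbit[of z b] by metis
  define d where "d = min d1 d2 / (2 * C2)"
  have d_pos: "d > 0" using d1 d2 by (simp add: d_def)
  have C2d: "C2 * d \<le> d1 / 2" "C2 * d \<le> d2 / 2" using d2 by (auto simp: d_def)
  have "d \<le> C2 * d" using d2 d_pos by simp
  then have d: "d \<le> d1 / 2" "d \<le> d2 / 2" using C2d by linarith+
  have "dist (\<phi> (t + s) u) (\<phi> t w) \<le> C1 * C2 * (1 + b) * (1 + \<bar>t\<bar>) * dist (\<phi> s u) w"
    if u: "u \<in> ball z d" and w: "w \<in> ball (\<phi> s u) d" for u s t w
  proof -
    have u1: "u \<in> ball z d1" using u d d1 by auto
    obtain r where r: "r \<in> {0..b}" "\<phi> s u = \<phi> r u" using reduce[OF u1] by blast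
    have "dist (\<phi> r z) (\<phi> r u) \<le> C2 * dist z u"
      using C2[of z 0 u r] u d d2 r(1) by auto
    also have "\<dots> < C2 * d" using u d2 by (intro mult_strict_left_mono) auto
    finally have ru: "dist (\<phi> r z) (\<phi> r u) < d2 / 2" using C2d by linarith
    have rw: "dist (\<phi> r u) w < d" using w r by simp
    have "dist (\<phi> r z) w \<le> dist (\<phi> r z) (\<phi> r u) + dist (\<phi> r u) w" by (rule dist_triangle)
    then have "dist (\<phi> r z) w < d2" using ru rw d by linarith
    then have "dist (\<phi> (- r) (\<phi> r u)) (\<phi> (- r) w) \<le> C2 * dist (\<phi> r u) w"
      using ru d2(1) r(1) by (intro C2[of _ r]) auto
    then have u': "dist u (\<phi> (- r) w) \<le> C2 * dist (\<phi> r u) w" by simp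
    also have "\<dots> < C2 * d" using rw d2 by (intro mult_strict_left_mono) auto
    finally have "dist u (\<phi> (- r) w) < d1 / 2" using C2d by linarith
    moreover have "dist z u < d1 / 2" using u d by simp
    ultimately have "dist z (\<phi> (- r) w) < d1" using dist_triangle[of z "\<phi> (- r) w" u] by linarith
    then have "dist (\<phi> (t + r) u) (\<phi> (t + r) (\<phi> (- r) w)) \<le> C1 * (1 + \<bar>t + r\<bar>) * dist u (\<phi> (- r) w)"
      using u1 by (intro growth) auto
    also have "\<dots> \<le> C1 * ((1 + b) * (1 + \<bar>t\<bar>)) * (C2 * dist (\<phi> r u) w)"
    proof (intro mult_mono u')
      have "1 + \<bar>t + r\<bar> \<le> 1 + (\<bar>t\<bar> + b)" using r(1) by auto
      also have "\<dots> \<le> (1 + b) * (1 + \<bar>t\<bar>)" using b by (simp add: algebra_simps)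
      finally show "1 + \<bar>t + r\<bar> \<le> (1 + b) * (1 + \<bar>t\<bar>)" .
    qed (use d1 b in auto)
    also have "\<phi> (t + r) u = \<phi> (t + s) u" by (simp add: flow_add r)
    also have "\<phi> (t + r) (\<phi> (- r) w) = \<phi> t w" by (simp flip: flow_add)
    finally show ?thesis by (simp add: r mult_ac)
  qed
  moreover have "C1 * C2 * (1 + b) \<ge> 1"
    using d1 d2 b mult_mono[of 1 "C1 * C2" 1 "1 + b"] mult_mono[of 1 C1 1 C2] by simp
  ultimately show thesis
    using that[OF d_pos, of "C1 * C2 * (1 + b)" R] R d d1 by auto
qed

end

subsection \<open>Asymptotic behaviour of perturbed solutions\<close>

text \<open>Mean value theorem. With q = p - 2 the term of order \<open>t powr (1 - p)\<close> is
  bounded by a difference, so tails of the series have an explicit bound.\<close>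

lemma powr_le_telescope:
  fixes q t :: real
  assumes "q > 0" "t > 1"
  shows "q * t powr (- 1 - q) \<le> (t - 1) powr (- q) - t powr (- q)"
proof -
  have "\<exists>\<xi>>t - 1. \<xi> < t \<and> t powr (- q) - (t - 1) powr (- q) = (t - (t - 1)) * (- q * \<xi> powr (- q - 1))"
    using assms(2) by (intro MVT2) (auto intro!: derivative_eq_intros)
  then obtain \<xi> where \<xi>: "t - 1 < \<xi>" "\<xi> < t"
    "t powr (- q) - (t - 1) powr (- q) = - q * \<xi> powr (- q - 1)" by auto
  have "t powr (- q - 1) \<le> \<xi> powr (- q - 1)"
    using \<xi> assms by (intro powr_mono2') auto
  then have "q * t powr (- q - 1) \<le> q * \<xi> powr (- q - 1)"
    using assms(1) by (intro mult_left_mono) auto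
  moreover have e: "- 1 - q = - q - 1" by simp
  ultimately show ?thesis unfolding e using \<xi>(3) by linarith
qed

context compact_orbit_flow
begin

text \<open>Transporting \<open>x (N + i)\<close> back to time \<open>N\<close> along the unperturbed flow gives a Cauchy sequence:
  the error \<open>t\<^sup>-\<^sup>p\<close> made in one unit of time is magnified at most by a factor of order \<open>t\<close>, and
  \<open>t\<^sup>1\<^sup>-\<^sup>p\<close> is summable.\<close>

lemma bounded_perturbed_solution_converges:
  assumes d: "d > 0" and C: "C \<ge> 1"
    and growth: "\<And>u s t w. u \<in> ball z d \<Longrightarrow> w \<in> ball (\<phi> s u) d \<Longrightarrow>
      dist (\<phi> (t + s) u) (\<phi> t w) \<le> C * (1 + \<bar>t\<bar>) * dist (\<phi> s u) w"
    and R: "\<And>u t. u \<in> ball z d \<Longrightarrow> norm (\<phi> t u) \<le> R"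
    and x: "ode_solution_on (\<lambda>t y. F y + h t) x {t0..}" and bdd: "bounded (x ` {t0..})"
    and p: "p > 2" and h: "\<And>t. t \<ge> t1 \<Longrightarrow> norm (h t) \<le> t powr (- p)"
    and cluster: "\<And>N e. e > 0 \<Longrightarrow> \<exists>t\<ge>N. dist (x t) z < e"
  shows "\<exists>y. ode_solution_on (\<lambda>t. F) y UNIV \<and> ((\<lambda>t. dist (x t) (y t)) \<longlongrightarrow> 0) at_top"
proof -
  obtain B where B: "\<And>t. t \<ge> t0 \<Longrightarrow> norm (x t) \<le> B"
    using bdd by (auto simp: bounded_iff)
  obtain L where L: "L-lipschitz_on (cball 0 (max R B)) F" using lip by blast
  have L0: "L \<ge> 0" using L by (rule lipschitz_on_nonneg)
  define E where "E = exp (L + 1)"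
  have E: "E > 0" by (simp add: E_def)
  have step: "dist (x s) (\<phi> (s - t + q) u) \<le> E * (dist (x t) (\<phi> q u) + t powr (- p))"
    if t: "t \<ge> t0" "t \<ge> t1" "t \<ge> 1" and s: "t \<le> s" "s \<le> t + 1" and u: "u \<in> ball z d" for t s q u
  proof -
    have "dist (x s) (\<phi> (s + (q - t)) u) \<le>
        exp (L * \<bar>s - t\<bar> + 1) * (dist (x t) (\<phi> (t + (q - t)) u) + t powr (- p) * \<bar>s - t\<bar>)"
    proof (rule perturbed_solution_dist[OF L])
      show "ode_solution_on (\<lambda>t. F) (\<lambda>s. \<phi> (s + (q - t)) u) (closed_segment t s)"
        using flow_shift_solution by (rule ode_solution_on_subset) simp
      show "ode_solution_on (\<lambda>t y. F y + h t) x (closed_segment t s)"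
        using x by (rule ode_solution_on_subset) (use s t in \<open>auto simp: closed_segment_eq_real_ivl\<close>)
      show "(\<lambda>s. \<phi> (s + (q - t)) u) ` closed_segment t s \<subseteq> cball 0 (max R B)"
        using R[OF u] by (auto simp: le_max_iff_disj)
      show "x ` closed_segment t s \<subseteq> cball 0 (max R B)"
        using B s t by (auto simp: closed_segment_eq_real_ivl le_max_iff_disj)
      fix r assume "r \<in> closed_segment t s"
      then have r: "t \<le> r" using s by (auto simp: closed_segment_eq_real_ivl)
      have "norm (h r) \<le> r powr (- p)" using h r t by auto
      also have "\<dots> \<le> t powr (- p)" using r t p by (intro powr_mono2') auto
      finally show "norm (h r) \<le> t powr (- p)" .
    qed simp
    also have "\<dots> \<le> E * (dist (x t) (\<phi> q u) + t powr (- p))"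
    proof (rule mult_mono)
      show "exp (L * \<bar>s - t\<bar> + 1) \<le> E"
        using s L0 mult_left_mono[of "\<bar>s - t\<bar>" 1 L] by (simp add: E_def)
      show "dist (x t) (\<phi> (t + (q - t)) u) + t powr (- p) * \<bar>s - t\<bar> \<le> dist (x t) (\<phi> q u) + t powr (- p)"
        using s mult_left_mono[of "\<bar>s - t\<bar>" 1 "t powr (- p)"] by simp
    qed (use E in auto)
    finally show ?thesis by (simp add: algebra_simps)
  qed
  \<comment> \<open>Made so that \<open>\<sigma> t - \<sigma> (t + 1)\<close> dominates the
    magnified error of the unit step from \<open>t\<close>; thus \<open>\<sigma> t\<close> bounds
    the whole drift after \<open>t\<close>.\<close>
  define \<sigma> where "\<sigma> t = C * E / (p - 2) * (t - 1) powr (2 - p)" for t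
  have \<sigma>_nonneg: "\<sigma> t \<ge> 0" for t using C E p by (simp add: \<sigma>_def)
  have \<sigma>_antimono: "\<sigma> t \<le> \<sigma> s" if "1 < s" "s \<le> t" for s t
    unfolding \<sigma>_def using that C E p by (intro mult_left_mono powr_mono2') auto
  have \<sigma>_step: "C * t * (E * t powr (- p)) \<le> \<sigma> t - \<sigma> (t + 1)" if t: "t > 1" for t
  proof -
    have "t powr (1 - p) = t * t powr (- p)" using t powr_add[of t 1 "- p"] by simp
    then have "C * t * (E * t powr (- p)) = C * E / (p - 2) * ((p - 2) * t powr (- 1 - (p - 2)))"
      using p by simp
    also have "\<dots> \<le> C * E / (p - 2) * ((t - 1) powr (- (p - 2)) - t powr (- (p - 2)))"
      using C E p t by (intro mult_left_mono powr_le_telescope) auto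
    also have "\<dots> = \<sigma> t - \<sigma> (t + 1)" by (simp add: \<sigma>_def right_diff_distrib)
    finally show ?thesis .
  qed
  have shift_top: "filterlim (\<lambda>t::real. t - c) at_top at_top" for c
    by (rule filterlim_at_top_mono[OF filterlim_tendsto_add_at_top[of "\<lambda>_. - c" "- c" _ "\<lambda>t. t"]])
       (auto simp: filterlim_ident)
  have \<sigma>_lim: "((\<lambda>t. \<sigma> (t - c)) \<longlongrightarrow> 0) at_top" for c
    unfolding \<sigma>_def diff_diff_eq
    using p by (intro tendsto_mult_right_zero tendsto_neg_powr shift_top) auto
  have powr_lim: "((\<lambda>t. E * (t - c) powr (- p)) \<longlongrightarrow> 0) at_top" for c
    using p by (intro tendsto_mult_right_zero tendsto_neg_powr shift_top) auto
  \<comment> \<open>N >= 3 gives 1 + |j - (i + 1)| <= N + i below and keeps \<open>\<sigma>\<close>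
    away from its singularity at 1. The two halves of \<open>d\<close> are the initial distance to
    \<open>z\<close> and the total drift; the bound on E N^(-p) keeps each single step in the
    tube.\<close>
  obtain N where N: "N \<ge> t0" "N \<ge> t1" "N \<ge> 3" "\<sigma> N < d / 2" "E * N powr (- p) < d" "dist (x N) z < d / 2"
  proof -
    have "\<forall>\<^sub>F t in at_top. t \<ge> t0 \<and> t \<ge> t1 \<and> t \<ge> 3 \<and> \<sigma> t < d / 2 \<and> E * t powr (- p) < d"
      using d order_tendstoD(2)[OF \<sigma>_lim[of 0], of "d / 2"] order_tendstoD(2)[OF powr_lim[of 0], of d]
      by (intro eventually_conj eventually_ge_at_top) auto
    then obtain N0 where "\<And>t. t \<ge> N0 \<Longrightarrow> t \<ge> t0 \<and> t \<ge> t1 \<and> t \<ge> 3 \<and> \<sigma> t < d / 2 \<and> E * t powr (- p) < d"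
      unfolding eventually_at_top_linorder by blast
    then show thesis using that cluster[of "d / 2" N0] d by (metis half_gt_zero)
  qed
  define a where "a i = \<phi> (- real i) (x (N + real i))" for i :: nat
  have flow_a: "\<phi> t (a i) = \<phi> (t - real i) (x (N + real i))" for t i
    by (simp add: a_def flip: flow_add)
  have near: "dist (x t) (\<phi> (t - N) (a i)) \<le> E * (N + real i) powr (- p)"
    if "a i \<in> ball z d" "N + real i \<le> t" "t \<le> N + real i + 1" for i t
    using step[of "N + real i" t "a i" "real i"] that N by (simp add: flow_a algebra_simps)
  \<comment> \<open>j = 0 suffices for the Cauchy property. Times up to i + 1 are needed to compare
    \<open>x\<close> with the limiting orbit on the unit interval that starts at N + i; the growth
    factor stays of order N + i there.\<close>
  have a_step: "dist (\<phi> j (a i)) (\<phi> j (a (Suc i))) \<le> \<sigma> (N + real i) - \<sigma> (N + real (Suc i))"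
    if a: "a i \<in> ball z d" and j: "0 \<le> j" "j \<le> real i + 1" for i j
  proof -
    define w where "w = x (N + real (Suc i))"
    define T where "T = N + real i"
    have T: "T \<ge> N" "T > 1" "1 + \<bar>j - real (Suc i)\<bar> \<le> T" using N j by (auto simp: T_def)
    have w: "dist (\<phi> (real (Suc i)) (a i)) w \<le> E * T powr (- p)"
      using near[OF a, of "N + real (Suc i)"] by (simp add: w_def T_def dist_commute)
    also have "\<dots> \<le> E * N powr (- p)"
      using T N E p by (intro mult_left_mono powr_mono2') auto
    also have "\<dots> < d" by (rule N)
    finally have "w \<in> ball (\<phi> (real (Suc i)) (a i)) d" by simp
    from growth[OF a this, of "j - real (Suc i)"]
    have "dist (\<phi> j (a i)) (\<phi> (j - real (Suc i)) w) \<le>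
        C * (1 + \<bar>j - real (Suc i)\<bar>) * dist (\<phi> (real (Suc i)) (a i)) w" by simp
    also have "\<dots> \<le> C * T * (E * T powr (- p))"
      using T w C by (intro mult_mono) auto
    also have "\<dots> \<le> \<sigma> T - \<sigma> (T + 1)" by (rule \<sigma>_step[OF T(2)])
    finally show ?thesis by (simp add: w_def T_def flow_a add_ac)
  qed
  have a0: "dist z (a 0) < d / 2" using N by (simp add: a_def dist_commute)
  \<comment> \<open>Lying in the ball is what \<open>a_step\<close> requires and what its estimate
    reproduces, since the drift sums to at most \<sigma> N < d / 2.\<close>
  have a_ball: "a i \<in> ball z d \<and> dist (a 0) (a i) \<le> \<sigma> N - \<sigma> (N + real i)" for i
  proof (induction i)
    case 0
    then show ?case using a0 d by simp
  next
    case (Suc i)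
    have "dist (a i) (a (Suc i)) \<le> \<sigma> (N + real i) - \<sigma> (N + real (Suc i))"
      using a_step[of i 0] Suc by simp
    then have 1: "dist (a 0) (a (Suc i)) \<le> \<sigma> N - \<sigma> (N + real (Suc i))"
      using Suc dist_triangle[of "a 0" "a (Suc i)" "a i"] by linarith
    then have "dist z (a (Suc i)) < d"
      using a0 N(4) \<sigma>_nonneg[of "N + real (Suc i)"] dist_triangle[of z "a (Suc i)" "a 0"] by linarith
    then show ?case using 1 by simp
  qed
  have tail: "dist (\<phi> j (a i)) (\<phi> j (a (i + k))) \<le> \<sigma> (N + real i) - \<sigma> (N + real (i + k))"
    if j: "0 \<le> j" "j \<le> real i + 1" for i j k
  proof (induction k)
    case (Suc k)
    have "dist (\<phi> j (a (i + k))) (\<phi> j (a (Suc (i + k)))) \<le>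
        \<sigma> (N + real (i + k)) - \<sigma> (N + real (Suc (i + k)))"
      using a_ball j by (intro a_step) auto
    then show ?case
      using Suc dist_triangle[of "\<phi> j (a i)" "\<phi> j (a (Suc (i + k)))" "\<phi> j (a (i + k))"]
      by simp
  qed simp
  have tail_le: "dist (\<phi> j (a i)) (\<phi> j (a m)) \<le> \<sigma> (N + real i)"
    if "0 \<le> j" "j \<le> real i + 1" "i \<le> m" for i j m
    using tail[OF that(1,2), of "m - i"] that(3) \<sigma>_nonneg[of "N + real m"] by simp
  have "Cauchy a"
  proof (rule metric_CauchyI)
    fix e :: real assume e: "e > 0"
    have "\<forall>\<^sub>F t in at_top. \<sigma> t < e / 2"
      using e order_tendstoD(2)[OF \<sigma>_lim[of 0], of "e / 2"] by simp
    then obtain t where t: "\<And>s. s \<ge> t \<Longrightarrow> \<sigma> s < e / 2"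
      unfolding eventually_at_top_linorder by blast
    define M where "M = nat \<lceil>t\<rceil>"
    have M: "\<sigma> (N + real M) < e / 2"
      by (rule t) (use N in \<open>unfold M_def, linarith\<close>)
    have "dist (a M) (a m) < e / 2" if "m \<ge> M" for m
      using tail_le[of 0 M m] that M by simp
    then show "\<exists>M. \<forall>m\<ge>M. \<forall>n\<ge>M. dist (a m) (a n) < e"
      by (metis dist_commute dist_triangle_half_l)
  qed
  then obtain a' where a': "a \<longlonglongrightarrow> a'" using Cauchy_convergent convergentD by blast
  have limit: "dist (\<phi> j (a i)) (\<phi> j a') \<le> \<sigma> (N + real i)" if "0 \<le> j" "j \<le> real i + 1" for i j
  proof (rule LIMSEQ_le_const2)
    have "isCont (\<phi> j) a'"
      using flow_continuous_space[of UNIV j] by (simp add: continuous_on_eq_continuous_at)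
    then show "(\<lambda>m. dist (\<phi> j (a i)) (\<phi> j (a m))) \<longlonglongrightarrow> dist (\<phi> j (a i)) (\<phi> j a')"
      by (intro tendsto_intros isCont_tendsto_compose[OF _ a'])
    show "\<exists>M. \<forall>m\<ge>M. dist (\<phi> j (a i)) (\<phi> j (a m)) \<le> \<sigma> (N + real i)"
      using tail_le[OF that] by blast
  qed
  have close: "dist (x t) (\<phi> (t + - N) a') \<le> E * (t - 1) powr (- p) + \<sigma> (t - 1)" if t: "t \<ge> N" for t
  proof -
    define i where "i = nat \<lfloor>t - N\<rfloor>"
    have i: "N + real i \<le> t" "t \<le> N + real i + 1" using t unfolding i_def by linarith+
    have "dist (x t) (\<phi> (t - N) (a i)) \<le> E * (N + real i) powr (- p)"
      using near a_ball i by blast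
    also have "\<dots> \<le> E * (t - 1) powr (- p)"
      using i t N E p by (intro mult_left_mono powr_mono2') auto
    finally have 1: "dist (x t) (\<phi> (t - N) (a i)) \<le> E * (t - 1) powr (- p)" .
    have "dist (\<phi> (t - N) (a i)) (\<phi> (t - N) a') \<le> \<sigma> (N + real i)"
      using i t by (intro limit) auto
    also have "\<dots> \<le> \<sigma> (t - 1)" using i t N by (intro \<sigma>_antimono) auto
    finally show ?thesis
      using 1 dist_triangle[of "x t" "\<phi> (t - N) a'" "\<phi> (t - N) (a i)"] by simp
  qed
  have "((\<lambda>t. dist (x t) (\<phi> (t + - N) a')) \<longlongrightarrow> 0) at_top"
  proof (rule Lim_null_comparison)
    show "\<forall>\<^sub>F t in at_top. norm (dist (x t) (\<phi> (t + - N) a')) \<le> E * (t - 1) powr (- p) + \<sigma> (t - 1)"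
      using eventually_ge_at_top[of N] by eventually_elim (use close in simp)
    show "((\<lambda>t. E * (t - 1) powr (- p) + \<sigma> (t - 1)) \<longlongrightarrow> 0) at_top"
      using tendsto_add[OF powr_lim[of 1] \<sigma>_lim[of 1]] by simp
  qed
  then show ?thesis using flow_shift_solution by blast
qed

end

section \<open>Planar centers and their products\<close>

text \<open>At the equilibrium there is no transversal section, so convergence to 0 is treated
  apart, with the equilibrium as limit solution. Otherwise boundedness yields an accumulation point
  away from 0, and arbitrarily late visits near it are all that the trapping argument asks
  for.\<close>

lemma perturbed_planar_center_converges:
  fixes F :: "real ^ 2 \<Rightarrow> real ^ 2"
  assumes F: "C1_map F" "global_center F"
    and x: "ode_solution_on (\<lambda>t y. F y + h t) x {t0..}" and bdd: "bounded (x ` {t0..})"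
    and p: "p > 2" and h: "\<And>t. t \<ge> t1 \<Longrightarrow> norm (h t) \<le> t powr (- p)"
  shows "\<exists>y. ode_solution_on (\<lambda>t. F) y UNIV \<and> ((\<lambda>t. dist (x t) (y t)) \<longlongrightarrow> 0) at_top"
proof (cases "(x \<longlongrightarrow> 0) at_top")
  case True
  have "F 0 = 0" using F(2) unfolding global_center_def by blast
  then have "ode_solution_on (\<lambda>t. F) (\<lambda>_. 0) UNIV"
    by (simp add: ode_solution_on_def)
  then show ?thesis using True by (intro exI[of _ "\<lambda>_. 0"]) (simp add: tendsto_norm_zero)
next
  case False
  then obtain e where e: "e > 0" "\<not> (\<forall>\<^sub>F t in at_top. dist (x t) 0 < e)"
    unfolding tendsto_iff by blast
  have "\<exists>t\<ge>max t0 (real n). e \<le> norm (x t)" for n :: nat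
  proof -
    have "\<not> (\<forall>t\<ge>max t0 (real n). dist (x t) 0 < e)"
      using e(2) unfolding eventually_at_top_linorder by blast
    then show ?thesis by (auto simp: not_less)
  qed
  then obtain \<tau> where \<tau>: "\<And>n. \<tau> n \<ge> t0" "\<And>n. \<tau> n \<ge> real n" "\<And>n. e \<le> norm (x (\<tau> n))"
    by (metis max.bounded_iff)
  have "bounded (range (x \<circ> \<tau>))"
    by (rule bounded_subset[OF bdd]) (use \<tau> in auto)
  then obtain z r where r: "strict_mono r" "((x \<circ> \<tau>) \<circ> r) \<longlonglongrightarrow> z"
    using bounded_imp_convergent_subsequence by blast
  have "e \<le> norm z"
    using \<tau>(3) by (intro LIMSEQ_le_const[OF tendsto_norm[OF r(2)]]) auto
  then have Fz: "F z \<noteq> 0" using F(2) e(1) unfolding global_center_def by auto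
  have cluster: "\<exists>t\<ge>M. dist (x t) z < \<epsilon>" if "\<epsilon> > 0" for M \<epsilon>
  proof -
    have "\<forall>\<^sub>F n in sequentially. dist (((x \<circ> \<tau>) \<circ> r) n) z < \<epsilon>"
      using r(2) that by (rule tendstoD)
    moreover have "\<forall>\<^sub>F n in sequentially. real n \<ge> M"
      using filterlim_real_sequentially unfolding filterlim_at_top by blast
    ultimately have "\<forall>\<^sub>F n in sequentially. dist (x (\<tau> (r n))) z < \<epsilon> \<and> \<tau> (r n) \<ge> M"
    proof eventually_elim
      case (elim n)
      then show ?case using \<tau>(2)[of "r n"] seq_suble[OF r(1), of n] by simp
    qed
    then show ?thesis using eventually_happens' by (metis (mono_tags, lifting) sequentially_bot)
  qed
  obtain \<phi> where \<phi>: "compact_orbit_flow F \<phi>" using exists_compact_orbit_flow[OF F] by blast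
  then interpret compact_orbit_flow F \<phi> .
  obtain T0 where T0: "T0 > 0" "\<And>e. e > 0 \<Longrightarrow> \<exists>d>0. \<forall>w\<in>ball z d. \<exists>S. \<bar>S - T0\<bar> < e \<and> \<phi> S w = w"
    using planar_nearby_periods[OF \<phi> Fz] by blast
  obtain d C R where tube: "d > 0" "C \<ge> 1"
    "\<And>u s t w. u \<in> ball z d \<Longrightarrow> w \<in> ball (\<phi> s u) d \<Longrightarrow>
      dist (\<phi> (t + s) u) (\<phi> t w) \<le> C * (1 + \<bar>t\<bar>) * dist (\<phi> s u) w"
    "\<And>u t. u \<in> ball z d \<Longrightarrow> norm (\<phi> t u) \<le> R"
    by (rule flow_linear_growth_near_orbits[OF Fz T0]) (assumption, rule that)
  show ?thesis
    by (rule bounded_perturbed_solution_converges[OF tube x bdd p h cluster])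
qed

text \<open>Component \<open>k\<close> of the field depends on all of \<open>x\<close>, so no planar
  field is available yet: the right-hand side is frozen along \<open>x\<close> and ignores
  \<open>y\<close>.\<close>

lemma ode_solution_on_nth:
  assumes "ode_solution_on G x I"
  shows "ode_solution_on (\<lambda>t y. G t (x t) $ k) (\<lambda>t. x t $ k) I"
  using assms bounded_linear.has_vector_derivative[OF bounded_linear_vec_nth]
  unfolding ode_solution_on_def by blast

lemma ode_solution_on_product_field:
  fixes f :: "'n::finite \<Rightarrow> real ^ 2 \<Rightarrow> real ^ 2"
  assumes "\<And>k. ode_solution_on (\<lambda>t. f k) (y k) UNIV"
  shows "ode_solution_on (\<lambda>t. product_field f) (\<lambda>t. \<chi> k. y k t) UNIV"
  unfolding ode_solution_on_def
proof
  fix t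
  have axis: "bounded_linear (axis k :: real ^ 2 \<Rightarrow> (real ^ 2) ^ 'n)" for k
    unfolding linear_conv_bounded_linear[symmetric]
    by (rule linearI) (simp_all add: axis_def vec_eq_iff)
  have "((\<lambda>t. \<Sum>k\<in>UNIV. axis k (y k t)) has_vector_derivative
      (\<Sum>k\<in>UNIV. axis k (f k (y k t)))) (at t)"
    using assms unfolding ode_solution_on_def
    by (intro has_vector_derivative_sum
        bounded_linear.has_vector_derivative[OF axis]) auto
  moreover have "(\<Sum>k\<in>UNIV. axis k (c k)) = (\<chi> k. c k)" for c :: "'n \<Rightarrow> real ^ 2"
    by (simp add: vec_eq_iff axis_def if_distrib cong: if_cong)
  ultimately show "((\<lambda>t. \<chi> k. y k t) has_vector_derivative product_field f (\<chi> k. y k t)) (at t within UNIV)"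
    by (simp add: product_field_def)
qed

text \<open>A bounded set has compact closure and bounded norms, so either form of decay is uniform
  on it. As t^p |g| tends to 0, its bound may be taken to be 1 from some time on, which removes
  every constant.\<close>

lemma decay_bounded_norm:
  assumes g: "decays_locally_uniformly p g \<or> decays_by_product_bound p g"
    and K: "bounded K"
  shows "\<exists>t1. \<forall>t\<ge>t1. \<forall>z\<in>K. norm (g t z) \<le> t powr (- p)"
proof -
  have "\<forall>\<^sub>F t in at_top. \<forall>z\<in>K. t powr p * norm (g t z) \<le> 1"
    using g
  proof
    assume "decays_locally_uniformly p g"
    then have "uniform_limit (closure K) (\<lambda>t x. t powr p * norm (g t x)) (\<lambda>x. 0) at_top"
      using K unfolding decays_locally_uniformly_def by simp
    then have "\<forall>\<^sub>F t in at_top. \<forall>z\<in>closure K. dist (t powr p * norm (g t z)) 0 < 1"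
      by (rule uniform_limitD) simp
    then show ?thesis
    proof eventually_elim
      case (elim t)
      then show ?case using closure_subset[of K] by (force simp: abs_mult)
    qed
  next
    assume "decays_by_product_bound p g"
    then obtain \<alpha> \<beta> :: "real \<Rightarrow> real" where \<alpha>: "\<forall>s\<ge>0. 0 < \<alpha> s" "mono_on {0..} \<alpha>"
      and \<beta>: "\<forall>t>0. 0 < \<beta> t" "(\<beta> \<longlongrightarrow> 0) at_top"
      and b: "\<forall>t>0. \<forall>x. t powr p * norm (g t x) \<le> \<alpha> (norm x) * \<beta> t"
      unfolding decays_by_product_bound_def by blast
    obtain B where B: "B > 0" "\<And>z. z \<in> K \<Longrightarrow> norm z \<le> B"
      using K unfolding bounded_pos by blast
    then have \<alpha>B: "\<alpha> B > 0" using \<alpha> by auto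
    have "\<forall>\<^sub>F t in at_top. \<beta> t < 1 / \<alpha> B"
      using \<alpha>B by (intro order_tendstoD(2)[OF \<beta>(2)]) auto
    then show ?thesis
      using eventually_gt_at_top[of 0]
    proof eventually_elim
      case (elim t)
      show ?case
      proof
        fix z assume z: "z \<in> K"
        have "t powr p * norm (g t z) \<le> \<alpha> (norm z) * \<beta> t" using b elim by blast
        also have "\<dots> \<le> \<alpha> B * \<beta> t"
          using B z \<beta>(1) elim by (intro mult_right_mono mono_onD[OF \<alpha>(2)]) auto
        also have "\<dots> \<le> 1" using elim \<alpha>B by (simp add: field_simps)
        finally show "t powr p * norm (g t z) \<le> 1" .
      qed
    qed
  qed
  then have "\<forall>\<^sub>F t in at_top. \<forall>z\<in>K. norm (g t z) \<le> t powr (- p)"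
    using eventually_gt_at_top[of 0]
    by eventually_elim (simp add: powr_minus field_simps)
  then show ?thesis unfolding eventually_at_top_linorder .
qed

theorem theorem5p2:
  fixes f :: "'n::finite \<Rightarrow> real ^ 2 \<Rightarrow> real ^ 2"
    and g :: "real \<Rightarrow> (real ^ 2) ^ 'n \<Rightarrow> (real ^ 2) ^ 'n"
    and p t0 :: real
    and x :: "real \<Rightarrow> (real ^ 2) ^ 'n"
  assumes "\<And>k. C1_map (f k)"
    and "\<And>k. global_center (f k)"
    and "C01_map g"
    and "p > 2"
    and "decays_locally_uniformly p g \<or> decays_by_product_bound p g"
    and "ode_solution_on (\<lambda>t z. product_field f z + g t z) x {t0..}"
    and "bounded (x ` {t0..})"
  shows "\<exists>y. ode_solution_on (\<lambda>t. product_field f) y UNIV \<and>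
             ((\<lambda>t. norm (x t - y t)) \<longlongrightarrow> 0) at_top"
proof -
  obtain t1 where t1: "\<And>t z. t \<ge> t1 \<Longrightarrow> z \<in> x ` {t0..} \<Longrightarrow> norm (g t z) \<le> t powr (- p)"
    using decay_bounded_norm[OF assms(5,7)] by blast
  have "\<exists>y. ode_solution_on (\<lambda>t. f k) y UNIV \<and> ((\<lambda>t. dist (x t $ k) (y t)) \<longlongrightarrow> 0) at_top" for k
  proof (rule perturbed_planar_center_converges[OF assms(1,2) _ _ assms(4)])
    show "ode_solution_on (\<lambda>t y. f k y + g t (x t) $ k) (\<lambda>t. x t $ k) {t0..}"
      by (rule ode_solution_on_cong[OF ode_solution_on_nth[OF assms(6)]])
         (auto simp: product_field_def)
    have "(\<lambda>t. x t $ k) ` {t0..} = (\<lambda>z. z $ k) ` x ` {t0..}" by auto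
    then show "bounded ((\<lambda>t. x t $ k) ` {t0..})"
      using bounded_linear_image[OF assms(7) bounded_linear_vec_nth] by simp
    \<comment> \<open>\<open>t1\<close> may precede \<open>t0\<close>, and \<open>x t\<close> is
      known to lie in the bounded set only from \<open>t0\<close> on.\<close>
    fix t assume "t \<ge> max t0 t1"
    then show "norm (g t (x t) $ k) \<le> t powr (- p)"
      using t1[of t "x t"] by (intro order_trans[OF Finite_Cartesian_Product.norm_nth_le]) auto
  qed
  then obtain y where y: "\<And>k. ode_solution_on (\<lambda>t. f k) (y k) UNIV"
    "\<And>k. ((\<lambda>t. dist (x t $ k) (y k t)) \<longlongrightarrow> 0) at_top" by metis
  have "((\<lambda>t. norm (x t - (\<chi> k. y k t))) \<longlongrightarrow> 0) at_top"
  proof (rule Lim_null_comparison)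
    have "norm v \<le> (\<Sum>k\<in>UNIV. norm (v $ k))" for v :: "(real ^ 2) ^ 'n"
      unfolding norm_vec_def by (rule L2_set_le_sum) simp
    from this[of "x t - (\<chi> k. y k t)" for t]
    show "\<forall>\<^sub>F t in at_top. norm (norm (x t - (\<chi> k. y k t))) \<le> (\<Sum>k\<in>UNIV. dist (x t $ k) (y k t))"
      by (auto simp: dist_norm)
    show "((\<lambda>t. \<Sum>k\<in>UNIV. dist (x t $ k) (y k t)) \<longlongrightarrow> 0) at_top"
      using y(2) by (intro tendsto_null_sum)
  qed
  then show ?thesis using ode_solution_on_product_field[where f = f and y = y, OF y(1)] by blast
qed

end
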